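(* Let $f:\mathbb{R}^n\to\mathbb{R}$ and assume that at least one of the following holds: (i) $f$ is convex, $f$ is locally Lipschitz continuous, the set $\Omega^2$ of points at which $f$ is not twice differentiable is a Lebesgue null set, and for all $x\in\mathbb{R}^n$ there is an open set $V\ni x$ such that $\{\nabla^2 f(y): y\in V\setminus\Omega^2\}$ is bounded; or (ii) $f$ is of max-type: there are a finite set $I$ and $C^3$ functions $f_k:\mathbb{R}^n\to\mathbb{R}$, $k\in I$, with $f(x)=\max_{k\in I} f_k(x)$ for all $x\in\mathbb{R}^n$, and $f$ is $C^2$ at every point at which it is differentiable. Let $x^0\in\mathbb{R}^n$ and let $(\varepsilon_j)_{j\in\mathbb{N}},(\tau_j)_{j\in\mathbb{N}}$ be sequences of positive reals converging to $0$. Let $(x^j)_j$ and $(\hat{x}^l)_l$ be the sequences generated by the abstract descent method (defined in the context) with these inputs. If the level set $\{y\in\mathbb{R}^n: f(y)\le f(x^0)\}$ is bounded, then $(x^j)_j$ has an accumulation point $x^*\in\mathbb{R}^n$ and all accumulation points of $(x^j)_j$ are critical points of $f$. Furthermore, $f(\hat{x}^l)\to f(x^* )$ as $l\to\infty$.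
   Context: Notation. $\|\cdot\|$ is the Euclidean norm and $B_\delta(x)=\{y\in\mathbb{R}^n:\|x-y\|\le\delta\}$. $f$ is $C^2$ at a point if it is twice continuously differentiable on an open neighborhood of that point. $\Omega$ is the set of points where $f$ is not differentiable, $\Omega^2$ the set of points where $f$ is not twice differentiable. The Clarke subdifferential is $\partial f(x)=\mathrm{conv}\{\xi\in\mathbb{R}^n:\exists (y^i)_i\subset\mathbb{R}^n\setminus\Omega,\ y^i\to x,\ \nabla f(y^i)\to\xi\}$; a point $x$ is critical if $0\in\partial f(x)$. Second-order $\varepsilon$-jet. For $x\in\mathbb{R}^n$, $\varepsilon\ge0$, $$\mathcal{J}^2_\varepsilon f(x)=\bigcap_{\delta>\varepsilon}\overline{\{(y,f(y),\nabla f(y),\nabla^2 f(y)): y\in B_\delta(x)\setminus\Omega^2\}}\subseteq\mathbb{R}^n\times\mathbb{R}\times\mathbb{R}^n\times\mathbb{R}^{n\times n}.$$ Model. Let $$\mathcal{T}_{x,\varepsilon}(z)=\max_{(y,f(y),\xi,\mathcal{H})\in \mathcal{J}^2_\varepsilon f(x)} f(y)+\xi^\top(z-y)+\tfrac12(z-y)^\top\mathcal{H}(z-y),$$ let $\bar z(x,\varepsilon)$ be an arbitrary (global) minimizer of $\mathcal{T}_{x,\varepsilon}$ over $B_\varepsilon(x)$, and let $\theta(x,\varepsilon)=\mathcal{T}_{x,\varepsilon}(\bar z(x,\varepsilon))$ be the minimal value. Abstract descent method (inputs $x^0$, $(\varepsilon_j)_j$, $(\tau_j)_j$): 1. Set $j=1$,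 $i=0$, $x^{1,0}=x^0$. 2. Compute $\bar z(x^{j,i},\varepsilon_j)$ and $\theta(x^{j,i},\varepsilon_j)$. 3. If $(\theta(x^{j,i},\varepsilon_j)-f(x^{j,i}))/\varepsilon_j>-\tau_j$, set $x^{j+1,0}=x^{j,i}$, then $j\leftarrow j+1$, $i\leftarrow0$. 4. Else set $x^{j,i+1}=\bar z(x^{j,i},\varepsilon_j)$ and $i\leftarrow i+1$. 5. Go to 2. For each $j$, let $N_j\in\mathbb{N}\cup\{0,\infty\}$ be the number of descent steps (executions of step 4) performed for this $j$; set $x^j:=x^{j,N_j}=x^{j+1,0}$ (if $N_j=\infty$ for some $j$, then $(x^j)_j$ is a finite sequence). The sequence of all iterates is $(\hat x^l)_l=(x^{1,0},x^{1,1},\dots,x^{1,N_1},x^{2,0},x^{2,1},\dots,x^{2,N_2},\dots)$. *)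

theory Defs
  imports "HOL-Analysis.Analysis"
begin

definition grad :: "(real ^ 'n \<Rightarrow> real) \<Rightarrow> real ^ 'n \<Rightarrow> real ^ 'n" where
  "grad f x = (THE g. GDERIV f x :> g)"

definition hessian :: "(real ^ 'n \<Rightarrow> real) \<Rightarrow> real ^ 'n \<Rightarrow> real ^ 'n ^ 'n" where
  "hessian f x = jacobian (grad f) (at x)"

definition twice_differentiable_at :: "(real ^ 'n \<Rightarrow> real) \<Rightarrow> real ^ 'n \<Rightarrow> bool" where
  "twice_differentiable_at f x \<longleftrightarrow>
     (\<forall>\<^sub>F y in nhds x. f differentiable (at y)) \<and> grad f differentiable (at x)"

text \<open>The points at which \<open>f\<close> is not twice differentiable.\<close>

definition Omega2 :: "(real ^ 'n \<Rightarrow> real) \<Rightarrow> (real ^ 'n) set" where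
  "Omega2 f = {x. \<not> twice_differentiable_at f x}"

text \<open>\<open>Ck_on k S f\<close> is meant for open \<open>S\<close>: \<open>f\<close> is \<open>k\<close> times continuously differentiable
  on \<open>S\<close>, by recursion through the partial derivatives.\<close>

primrec Ck_on :: "nat \<Rightarrow> (real ^ 'n) set \<Rightarrow> (real ^ 'n \<Rightarrow> real) \<Rightarrow> bool" where
  "Ck_on 0 S f \<longleftrightarrow> continuous_on S f"
| "Ck_on (Suc k) S f \<longleftrightarrow>
     (\<forall>x\<in>S. f differentiable (at x)) \<and> (\<forall>i. Ck_on k S (\<lambda>x. grad f x $ i))"

definition C2_at :: "(real ^ 'n \<Rightarrow> real) \<Rightarrow> real ^ 'n \<Rightarrow> bool" where
  "C2_at f x \<longleftrightarrow> (\<exists>U. open U \<and> x \<in> U \<and> Ck_on 2 U f)"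

definition locally_Lipschitz :: "(real ^ 'n \<Rightarrow> real) \<Rightarrow> bool" where
  "locally_Lipschitz f \<longleftrightarrow> (\<forall>x. \<exists>U L. open U \<and> x \<in> U \<and> L-lipschitz_on U f)"

text \<open>The index set is a set of natural numbers without loss of generality, being finite.\<close>

definition max_type :: "(real ^ 'n \<Rightarrow> real) \<Rightarrow> bool" where
  "max_type f \<longleftrightarrow>
     (\<exists>(I :: nat set) F. finite I \<and> I \<noteq> {} \<and> (\<forall>k\<in>I. Ck_on 3 UNIV (F k)) \<and>
        (\<forall>x. f x = Max ((\<lambda>k. F k x) ` I))) \<and>
     (\<forall>x. f differentiable (at x) \<longrightarrow> C2_at f x)"

definition clarke_subdifferential :: "(real ^ 'n \<Rightarrow> real) \<Rightarrow> real ^ 'n \<Rightarrow> (real ^ 'n) set" where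
  "clarke_subdifferential f x = convex hull
     {\<xi>. \<exists>y. (\<forall>i::nat. f differentiable (at (y i))) \<and> y \<longlonglongrightarrow> x \<and> (\<lambda>i. grad f (y i)) \<longlonglongrightarrow> \<xi>}"

definition critical :: "(real ^ 'n \<Rightarrow> real) \<Rightarrow> real ^ 'n \<Rightarrow> bool" where
  "critical f x \<longleftrightarrow> 0 \<in> clarke_subdifferential f x"

definition jet2 ::
  "(real ^ 'n \<Rightarrow> real) \<Rightarrow> real ^ 'n \<Rightarrow> real \<Rightarrow> ((real ^ 'n) \<times> real \<times> (real ^ 'n) \<times> (real ^ 'n ^ 'n)) set" where
  "jet2 f x \<epsilon> =
     (\<Inter>\<delta>\<in>{\<epsilon><..}. closure ((\<lambda>y. (y, f y, grad f y, hessian f y)) ` (cball x \<delta> - Omega2 f)))"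

text \<open>The maximum over the jet is rendered as a real supremum. The two agree whenever the maximum
  exists, in particular when the jet is nonempty and compact and \<open>f\<close> is continuous.\<close>

definition model :: "(real ^ 'n \<Rightarrow> real) \<Rightarrow> real ^ 'n \<Rightarrow> real \<Rightarrow> real ^ 'n \<Rightarrow> real" where
  "model f x \<epsilon> z =
     Sup {f y + \<xi> \<bullet> (z - y) + 1 / 2 * ((z - y) \<bullet> (H *v (z - y))) | y \<xi> H. (y, f y, \<xi>, H) \<in> jet2 f x \<epsilon>}"

text \<open>In the following, \<open>zbar x \<epsilon>\<close> is a chosen minimizer of \<open>model f x \<epsilon>\<close> over \<open>cball x \<epsilon>\<close>.\<close>

definition is_minimizer_choice ::
  "(real ^ 'n \<Rightarrow> real) \<Rightarrow> (real ^ 'n \<Rightarrow> real \<Rightarrow> real ^ 'n) \<Rightarrow> bool" where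
  "is_minimizer_choice f zbar \<longleftrightarrow>
     (\<forall>x \<epsilon>. \<epsilon> > 0 \<longrightarrow> is_arg_min (model f x \<epsilon>) (\<lambda>z. z \<in> cball x \<epsilon>) (zbar x \<epsilon>))"

definition \<theta> ::
  "(real ^ 'n \<Rightarrow> real) \<Rightarrow> (real ^ 'n \<Rightarrow> real \<Rightarrow> real ^ 'n) \<Rightarrow> real ^ 'n \<Rightarrow> real \<Rightarrow> real" where
  "\<theta> f zbar x \<epsilon> = model f x \<epsilon> (zbar x \<epsilon>)"

text \<open>A state \<open>(j, i, x)\<close> of the descent method consists of the two counters and the current
  iterate. One pass through the loop either advances \<open>j\<close>, keeping the iterate and resetting \<open>i\<close>,
  or makes a descent step.\<close>

definition stops ::
  "(real ^ 'n \<Rightarrow> real) \<Rightarrow> (real ^ 'n \<Rightarrow> real \<Rightarrow> real ^ 'n) \<Rightarrow> (nat \<Rightarrow> real) \<Rightarrow> (nat \<Rightarrow> real) \<Rightarrow>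
   nat \<Rightarrow> real ^ 'n \<Rightarrow> bool" where
  "stops f zbar \<epsilon> \<tau> j x \<longleftrightarrow> (\<theta> f zbar x (\<epsilon> j) - f x) / \<epsilon> j > - \<tau> j"

definition loop_pass ::
  "(real ^ 'n \<Rightarrow> real) \<Rightarrow> (real ^ 'n \<Rightarrow> real \<Rightarrow> real ^ 'n) \<Rightarrow> (nat \<Rightarrow> real) \<Rightarrow> (nat \<Rightarrow> real) \<Rightarrow>
   nat \<times> nat \<times> (real ^ 'n) \<Rightarrow> nat \<times> nat \<times> (real ^ 'n)" where
  "loop_pass f zbar \<epsilon> \<tau> = (\<lambda>(j, i, x).
     if stops f zbar \<epsilon> \<tau> j x then (j + 1, 0, x) else (j, i + 1, zbar x (\<epsilon> j)))"

definition run ::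
  "(real ^ 'n \<Rightarrow> real) \<Rightarrow> (real ^ 'n \<Rightarrow> real \<Rightarrow> real ^ 'n) \<Rightarrow> (nat \<Rightarrow> real) \<Rightarrow> (nat \<Rightarrow> real) \<Rightarrow>
   real ^ 'n \<Rightarrow> nat \<Rightarrow> nat \<times> nat \<times> (real ^ 'n)" where
  "run f zbar \<epsilon> \<tau> x0 l = (loop_pass f zbar \<epsilon> \<tau> ^^ l) (1, 0, x0)"

text \<open>The iterate \<open>x\<^sup>j\<^sup>,\<^sup>i\<close>; a pair \<open>(j, i)\<close> is visited at most once in the run.\<close>

definition iterate ::
  "(real ^ 'n \<Rightarrow> real) \<Rightarrow> (real ^ 'n \<Rightarrow> real \<Rightarrow> real ^ 'n) \<Rightarrow> (nat \<Rightarrow> real) \<Rightarrow> (nat \<Rightarrow> real) \<Rightarrow>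
   real ^ 'n \<Rightarrow> nat \<Rightarrow> nat \<Rightarrow> real ^ 'n" where
  "iterate f zbar \<epsilon> \<tau> x0 j i = (THE x. \<exists>l. run f zbar \<epsilon> \<tau> x0 l = (j, i, x))"

text \<open>The number \<open>N\<^sub>j\<close> of descent steps made for \<open>j\<close>.\<close>

definition descent_count ::
  "(real ^ 'n \<Rightarrow> real) \<Rightarrow> (real ^ 'n \<Rightarrow> real \<Rightarrow> real ^ 'n) \<Rightarrow> (nat \<Rightarrow> real) \<Rightarrow> (nat \<Rightarrow> real) \<Rightarrow>
   real ^ 'n \<Rightarrow> nat \<Rightarrow> enat" where
  "descent_count f zbar \<epsilon> \<tau> x0 j =
     (let D = {l. \<exists>i x. run f zbar \<epsilon> \<tau> x0 l = (j, i, x) \<and> \<not> stops f zbar \<epsilon> \<tau> j x}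
      in if finite D then enat (card D) else \<infinity>)"

text \<open>The sequence \<open>x\<^sup>j\<close>, \<open>j \<ge> 1\<close>. It ends, with value \<open>None\<close> from then on, as soon as some \<open>N\<^sub>j\<close>
  is infinite.\<close>

definition outer_iterate ::
  "(real ^ 'n \<Rightarrow> real) \<Rightarrow> (real ^ 'n \<Rightarrow> real \<Rightarrow> real ^ 'n) \<Rightarrow> (nat \<Rightarrow> real) \<Rightarrow> (nat \<Rightarrow> real) \<Rightarrow>
   real ^ 'n \<Rightarrow> nat \<Rightarrow> (real ^ 'n) option" where
  "outer_iterate f zbar \<epsilon> \<tau> x0 j =
     (if j \<ge> 1 \<and> (\<forall>k\<in>{1..j}. descent_count f zbar \<epsilon> \<tau> x0 k \<noteq> \<infinity>)
      then Some (iterate f zbar \<epsilon> \<tau> x0 j (the_enat (descent_count f zbar \<epsilon> \<tau> x0 j)))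
      else None)"

text \<open>The sequence \<open>x\<^sup>1\<^sup>,\<^sup>0, \<dots>, x\<^sup>1\<^sup>,\<^sup>N\<^sup>1, x\<^sup>2\<^sup>,\<^sup>0, \<dots>\<close> of all iterates: each pass through the loop
  produces the next entry. The final iterate for \<open>j\<close> occurs a second time as the first one for
  \<open>j + 1\<close>.\<close>

definition all_iterates ::
  "(real ^ 'n \<Rightarrow> real) \<Rightarrow> (real ^ 'n \<Rightarrow> real \<Rightarrow> real ^ 'n) \<Rightarrow> (nat \<Rightarrow> real) \<Rightarrow> (nat \<Rightarrow> real) \<Rightarrow>
   real ^ 'n \<Rightarrow> nat \<Rightarrow> real ^ 'n" where
  "all_iterates f zbar \<epsilon> \<tau> x0 l = snd (snd (run f zbar \<epsilon> \<tau> x0 l))"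

text \<open>Accumulation points are limits of subsequences. A sequence that ends has none.\<close>

definition accumulation_point :: "(nat \<Rightarrow> 'a::topological_space option) \<Rightarrow> 'a \<Rightarrow> bool" where
  "accumulation_point X a \<longleftrightarrow>
     (\<exists>r y. strict_mono r \<and> (\<forall>k::nat. X (r k) = Some (y k)) \<and> y \<longlonglongrightarrow> a)"

end

theory Submission
  imports Defs
begin

text \<open>Both hypotheses make \<open>f\<close> locally bounded from below by its first-order Taylor expansions up to
  a quadratic error; for a maximum this holds for each active piece. The model dominates \<open>f\<close> on
  the \<open>\<epsilon>\<close>-ball, since a jet element based at \<open>z\<close> contributes the value \<open>f z\<close>, so each step with
  \<open>\<theta> - f x \<le> - \<tau>\<^sub>j \<epsilon>\<^sub>j\<close> decreases \<open>f\<close> by at least \<open>\<tau>\<^sub>j \<epsilon>\<^sub>j\<close> and every \<open>N\<^sub>j\<close> is finite.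
  Conversely the model exceeds \<open>f\<close> by at most \<open>O(\<epsilon>\<^sup>2)\<close>. If an accumulation point \<open>a\<close> is not
  critical, separating \<open>0\<close> from the compact Clarke subdifferential gives a direction \<open>d\<close> along which
  \<open>f\<close> decreases near \<open>a\<close> at some rate \<open>c > 0\<close>; then \<open>\<theta> - f x \<le> - c \<epsilon>\<^sub>j + O(\<epsilon>\<^sub>j\<^sup>2)\<close>, which
  contradicts the stopping criterion because \<open>\<tau>\<^sub>j\<close> tends to \<open>0\<close>.\<close>

subsection \<open>The model of a weakly convex function\<close>

lemma GDERIV_grad:
  assumes "f differentiable (at x)"
  shows "GDERIV f x :> grad f x"
proof -
  obtain f' where f': "(f has_derivative f') (at x)"
    using assms by (auto simp: differentiable_def)
  \<comment> \<open>The adjoint of the derivative, taken at 1, is its Riesz representative; the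
    uniqueness of that vector gives the definite description in \<open>grad\<close> its
    meaning.\<close>
  define g where "g = adjoint f' 1"
  have "f' = (\<lambda>h. h \<bullet> g)"
  proof
    show "f' h = h \<bullet> g" for h
      using adjoint_works[OF has_derivative_linear[OF f'], of h 1] by (simp add: g_def)
  qed
  with f' have g: "GDERIV f x :> g" by (simp add: gderiv_def)
  show ?thesis
    unfolding grad_def
  proof (rule theI[of _ g])
    show "g' = g" if "GDERIV f x :> g'" for g'
    proof -
      have "(\<lambda>h. h \<bullet> g') = (\<lambda>h. h \<bullet> g)"
        using that g unfolding gderiv_def by (rule has_derivative_unique)
      then show ?thesis by (metis vector_eq_ldot)
    qed
  qed (fact g)
qed

lemma GDERIV_unique: "GDERIV f x :> g \<Longrightarrow> GDERIV f x :> g' \<Longrightarrow> g = g'"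
  unfolding gderiv_def by (metis has_derivative_unique vector_eq_ldot)

lemma grad_eq: "GDERIV f x :> g \<Longrightarrow> grad f x = g"
  using GDERIV_grad GDERIV_unique differentiable_def gderiv_def by blast

lemma not_Omega2D:
  assumes "x \<notin> Omega2 f"
  shows "f differentiable (at x)" "grad f differentiable (at x)"
    "\<forall>\<^sub>F y in nhds x. f differentiable (at y)"
  using assms eventually_nhds_x_imp_x unfolding Omega2_def twice_differentiable_at_def by fastforce+

text \<open>Every entry is at most the norm of the matrix. The crude dimensional factor is harmless,
  since later estimates only ask for locally uniform constants.\<close>

lemma onorm_matrix_le:
  fixes H :: "real ^ 'n ^ 'n"
  shows "onorm ((*v) H) \<le> (real CARD('n))\<^sup>2 * norm H"
proof -
  have "\<bar>H $ i $ j\<bar> \<le> norm H" for i j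
    using component_le_norm_cart[of "H $ i" j] Finite_Cartesian_Product.norm_nth_le[of H i]
    by (rule order_trans)
  then show ?thesis
    using onorm_le_matrix_component[of H "norm H"] by (simp add: power2_eq_square)
qed

lemma abs_quadratic_form_le:
  fixes H :: "real ^ 'n ^ 'n"
  shows "\<bar>v \<bullet> (H *v v)\<bar> \<le> (real CARD('n))\<^sup>2 * norm H * (norm v)\<^sup>2"
proof -
  have "norm (H *v v) \<le> onorm ((*v) H) * norm v"
    by (rule onorm) simp
  also have "\<dots> \<le> (real CARD('n))\<^sup>2 * norm H * norm v"
    by (intro mult_right_mono onorm_matrix_le) simp
  finally have "norm v * norm (H *v v) \<le> norm v * ((real CARD('n))\<^sup>2 * norm H * norm v)"
    by (intro mult_left_mono) auto
  then show ?thesis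
    using Cauchy_Schwarz_ineq2[of v "H *v v"] by (simp add: power2_eq_square mult_ac)
qed

text \<open>The second-order expansion depends continuously on the jet element, so a bound over the
  generating points passes to their closure. The radius \<open>2 * \<epsilon>\<close> is one
  admissible choice in the intersection that defines the jet.\<close>

lemma jet2_le:
  fixes f :: "real ^ 'n \<Rightarrow> real"
  assumes "\<epsilon> > 0" and J: "(y, f y, \<xi>, H) \<in> jet2 f x \<epsilon>"
    and M: "\<And>y. y \<in> cball x (2 * \<epsilon>) - Omega2 f \<Longrightarrow>
       f y + grad f y \<bullet> (z - y) + 1 / 2 * ((z - y) \<bullet> (hessian f y *v (z - y))) \<le> M"
  shows "f y + \<xi> \<bullet> (z - y) + 1 / 2 * ((z - y) \<bullet> (H *v (z - y))) \<le> M"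
proof -
  let ?T = "\<lambda>p :: (real ^ 'n) \<times> real \<times> (real ^ 'n) \<times> (real ^ 'n ^ 'n).
    fst (snd p) + fst (snd (snd p)) \<bullet> (z - fst p)
      + 1 / 2 * ((z - fst p) \<bullet> (snd (snd (snd p)) *v (z - fst p)))"
  have "closed {p. ?T p \<le> M}"
    by (intro closed_Collect_le continuous_intros)
      (simp_all add: matrix_vector_mult_def continuous_intros)
  moreover have "(\<lambda>y. (y, f y, grad f y, hessian f y)) ` (cball x (2 * \<epsilon>) - Omega2 f) \<subseteq> {p. ?T p \<le> M}"
    using M by auto
  ultimately have "closure ((\<lambda>y. (y, f y, grad f y, hessian f y)) ` (cball x (2 * \<epsilon>) - Omega2 f))
      \<subseteq> {p. ?T p \<le> M}"
    by (simp add: closure_minimal)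
  moreover have "2 * \<epsilon> \<in> {\<epsilon><..}" using assms(1) by simp
  then have "(y, f y, \<xi>, H) \<in> closure ((\<lambda>y. (y, f y, grad f y, hessian f y)) ` (cball x (2 * \<epsilon>) - Omega2 f))"
    using J unfolding jet2_def by blast
  ultimately show ?thesis by auto
qed

text \<open>The common ground of the two cases. \<open>lower\<close> is weak convexity with a
  locally uniform constant, seen from twice differentiable points. \<open>grad_bound\<close> covers
  all points of differentiability because these generate the Clarke subdifferential, whereas
  \<open>hess_bound\<close> and \<open>lower\<close> range over the base points that generate the
  jet.\<close>

locale weakly_convex =
  fixes f :: "real ^ 'n \<Rightarrow> real"
  assumes cont: "continuous_on UNIV f"
    and dense: "closure (- Omega2 f) = UNIV"
    and grad_bound: "\<exists>C. \<forall>y\<in>cball 0 R. f differentiable (at y) \<longrightarrow> norm (grad f y) \<le> C"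
    and hess_bound: "bounded (hessian f ` (cball 0 R - Omega2 f))"
    and lower: "\<exists>C\<ge>0. \<forall>y\<in>cball 0 R - Omega2 f. \<forall>z\<in>cball 0 R.
      f y + grad f y \<bullet> (z - y) \<le> f z + C * (norm (z - y))\<^sup>2"
begin

text \<open>Hessians are bounded on a ball, so the quadratic term of the expansion only enlarges the
  constant from \<open>lower\<close>.\<close>

lemma second_order_lower:
  "\<exists>C\<ge>0. \<forall>y\<in>cball 0 R - Omega2 f. \<forall>z\<in>cball 0 R.
     f y + grad f y \<bullet> (z - y) + 1 / 2 * ((z - y) \<bullet> (hessian f y *v (z - y)))
       \<le> f z + C * (norm (z - y))\<^sup>2"
proof -
  obtain C where C: "C \<ge> 0" "\<And>y z. y \<in> cball 0 R - Omega2 f \<Longrightarrow> z \<in> cball 0 R \<Longrightarrow>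
      f y + grad f y \<bullet> (z - y) \<le> f z + C * (norm (z - y))\<^sup>2"
    using lower[of R] by blast
  obtain B where B: "B > 0" "\<And>y. y \<in> cball 0 R - Omega2 f \<Longrightarrow> norm (hessian f y) \<le> B"
    using hess_bound[of R] by (auto simp: bounded_pos)
  define D where "D = (real CARD('n))\<^sup>2 * B"
  have D: "D \<ge> 0" using B by (simp add: D_def)
  have "f y + grad f y \<bullet> (z - y) + 1 / 2 * ((z - y) \<bullet> (hessian f y *v (z - y)))
       \<le> f z + (C + D) * (norm (z - y))\<^sup>2"
    if "y \<in> cball 0 R - Omega2 f" "z \<in> cball 0 R" for y z
  proof -
    have "(z - y) \<bullet> (hessian f y *v (z - y)) \<le> (real CARD('n))\<^sup>2 * norm (hessian f y) * (norm (z - y))\<^sup>2"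
      using abs_quadratic_form_le[of "z - y" "hessian f y"] by linarith
    also have "\<dots> \<le> D * (norm (z - y))\<^sup>2"
      unfolding D_def using B(2)[OF that(1)] by (intro mult_right_mono mult_left_mono) auto
    finally have 1: "(z - y) \<bullet> (hessian f y *v (z - y)) \<le> D * (norm (z - y))\<^sup>2" .
    have "0 \<le> D * (norm (z - y))\<^sup>2" using D by simp
    then show ?thesis using 1 C(2)[OF that] by (simp add: distrib_right)
  qed
  then show ?thesis using C(1) D by (intro exI[of _ "C + D"]) auto
qed

lemma ex_seq_not_Omega2:
  obtains u where "\<And>k :: nat. u k \<notin> Omega2 f" "u \<longlonglongrightarrow> z"
proof -
  have "z \<in> closure (- Omega2 f)" by (simp add: dense)
  then show ?thesis using that unfolding closure_sequential by blast
qed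

text \<open>Twice differentiable points approach \<open>z\<close> by density, and along them
  gradients and Hessians are bounded, so a subsequence converges. As \<open>z\<close> is within
  \<epsilon> of \<open>x\<close>, its tail lies in each ball of radius \<delta> > \<epsilon>, even
  when \<open>z\<close> is on the boundary.\<close>

lemma ex_mem_jet2:
  assumes "z \<in> cball x \<epsilon>"
  shows "\<exists>\<xi> H. (z, f z, \<xi>, H) \<in> jet2 f x \<epsilon>"
proof -
  obtain u where u: "\<And>k :: nat. u k \<notin> Omega2 f" "u \<longlonglongrightarrow> z"
    using ex_seq_not_Omega2[of z] by blast
  have "bounded (range u)" using u(2) convergent_imp_bounded by (auto simp: image_def)
  then obtain R where R: "\<And>k. norm (u k) \<le> R" by (auto simp: bounded_iff)
  obtain C where C: "\<And>y. y \<in> cball 0 R \<Longrightarrow> f differentiable (at y) \<Longrightarrow> norm (grad f y) \<le> C"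
    using grad_bound[of R] by blast
  have "bounded (range (\<lambda>k. grad f (u k)))"
    using C R not_Omega2D(1)[OF u(1)] by (auto simp: bounded_iff intro!: exI[of _ C])
  moreover have "bounded (range (\<lambda>k. hessian f (u k)))"
    by (rule bounded_subset[OF hess_bound[of R]]) (use R u(1) in auto)
  ultimately have "bounded (range (\<lambda>k. (grad f (u k), hessian f (u k))))"
    by (rule bounded_subset[OF bounded_Times]) auto
  then obtain p r where "strict_mono (r :: nat \<Rightarrow> nat)"
    "((\<lambda>k. (grad f (u k), hessian f (u k))) \<circ> r) \<longlonglongrightarrow> p"
    using bounded_imp_convergent_subsequence by blast
  then obtain \<xi> H where r: "strict_mono r"
    "((\<lambda>k. (grad f (u k), hessian f (u k))) \<circ> r) \<longlonglongrightarrow> (\<xi>, H)"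
    by (cases p) blast
  have lim: "(\<lambda>k. grad f (u (r k))) \<longlonglongrightarrow> \<xi>" "(\<lambda>k. hessian f (u (r k))) \<longlonglongrightarrow> H"
    using tendsto_fst[OF r(2)] tendsto_snd[OF r(2)] by (simp_all add: o_def)
  have ur: "(\<lambda>k. u (r k)) \<longlonglongrightarrow> z"
    using LIMSEQ_subseq_LIMSEQ[OF u(2) r(1)] by (simp add: o_def)
  have fur: "(\<lambda>k. f (u (r k))) \<longlonglongrightarrow> f z"
    using cont ur by (auto intro: continuous_on_tendsto_compose)
  have "(z, f z, \<xi>, H) \<in> closure ((\<lambda>y. (y, f y, grad f y, hessian f y)) ` (cball x \<delta> - Omega2 f))"
    if "\<delta> > \<epsilon>" for \<delta>
  proof (rule Lim_in_closed_set)
    show "((\<lambda>k. (u (r k), f (u (r k)), grad f (u (r k)), hessian f (u (r k)))) \<longlongrightarrow> (z, f z, \<xi>, H)) sequentially"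
      by (intro tendsto_Pair ur fur lim)
    have "\<forall>\<^sub>F k in sequentially. dist x (u (r k)) < \<delta>"
      by (rule order_tendstoD(2)[OF tendsto_dist[OF tendsto_const ur]]) (use assms that in auto)
    then show "\<forall>\<^sub>F k in sequentially. (u (r k), f (u (r k)), grad f (u (r k)), hessian f (u (r k)))
      \<in> closure ((\<lambda>y. (y, f y, grad f y, hessian f y)) ` (cball x \<delta> - Omega2 f))"
    proof eventually_elim
      case (elim k)
      then have "u (r k) \<in> cball x \<delta> - Omega2 f" using u(1) by simp
      then have "(u (r k), f (u (r k)), grad f (u (r k)), hessian f (u (r k)))
          \<in> (\<lambda>y. (y, f y, grad f y, hessian f y)) ` (cball x \<delta> - Omega2 f)"
        by (rule imageI)
      then show ?case by (rule subsetD[OF closure_subset])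
    qed
  qed auto
  then have "(z, f z, \<xi>, H) \<in> jet2 f x \<epsilon>" by (simp add: jet2_def)
  then show ?thesis by blast
qed

text \<open>In the expansion of a jet element based at \<open>z\<close> the linear and quadratic
  terms vanish, so \<open>f z\<close> is one of the values under the supremum.\<close>

lemma model_ge:
  assumes "\<epsilon> > 0" "z \<in> cball x \<epsilon>"
  shows "f z \<le> model f x \<epsilon> z"
proof -
  define R where "R = norm x + 2 * \<epsilon>"
  have R: "cball x (2 * \<epsilon>) \<subseteq> cball 0 R"
    unfolding R_def using cball_subset_cball_iff[of x "2 * \<epsilon>" 0] by simp
  moreover have "z \<in> cball x (2 * \<epsilon>)" using assms by simp
  ultimately have z: "z \<in> cball 0 R" by blast
  obtain C where C: "C \<ge> 0" "\<And>y. y \<in> cball 0 R - Omega2 f \<Longrightarrow>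
     f y + grad f y \<bullet> (z - y) + 1 / 2 * ((z - y) \<bullet> (hessian f y *v (z - y)))
       \<le> f z + C * (norm (z - y))\<^sup>2"
    using second_order_lower[of R] z by blast
  have "f y + grad f y \<bullet> (z - y) + 1 / 2 * ((z - y) \<bullet> (hessian f y *v (z - y)))
       \<le> f z + C * (2 * R)\<^sup>2" if "y \<in> cball x (2 * \<epsilon>) - Omega2 f" for y
  proof -
    have y: "y \<in> cball 0 R - Omega2 f" using that R by blast
    have "norm (z - y) \<le> 2 * R" using y z norm_triangle_ineq4[of z y] by simp
    then have "C * (norm (z - y))\<^sup>2 \<le> C * (2 * R)\<^sup>2"
      using C(1) by (intro mult_left_mono power_mono) auto
    then show ?thesis using C(2)[OF y] by linarith
  qed
  \<comment> \<open>A real supremum is known to dominate the members of its set only once that set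
    is bounded above.\<close>
  then have "bdd_above {f y + \<xi> \<bullet> (z - y) + 1 / 2 * ((z - y) \<bullet> (H *v (z - y))) |y \<xi> H.
      (y, f y, \<xi>, H) \<in> jet2 f x \<epsilon>}"
    using jet2_le[OF assms(1)] by (intro bdd_aboveI) blast
  moreover obtain \<xi> H where "(z, f z, \<xi>, H) \<in> jet2 f x \<epsilon>"
    using ex_mem_jet2[OF assms(2)] by blast
  then have "f z \<in> {f y + \<xi> \<bullet> (z - y) + 1 / 2 * ((z - y) \<bullet> (H *v (z - y))) |y \<xi> H.
      (y, f y, \<xi>, H) \<in> jet2 f x \<epsilon>}"
    by force
  ultimately show ?thesis unfolding model_def by (rule cSup_upper[rotated])
qed

text \<open>Base points within \<open>2 * \<epsilon>\<close> of \<open>x\<close> are within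
  \<open>3 * \<epsilon>\<close> of \<open>z\<close>; squaring this distance yields the factor 9.
  Enlarging the radius by 2 suffices because \<epsilon> \<le> 1.\<close>

lemma model_le:
  "\<exists>C\<ge>0. \<forall>x\<in>cball 0 R. \<forall>\<epsilon>. 0 < \<epsilon> \<longrightarrow> \<epsilon> \<le> 1 \<longrightarrow> (\<forall>z\<in>cball x \<epsilon>. model f x \<epsilon> z \<le> f z + C * \<epsilon>\<^sup>2)"
proof -
  obtain C where C: "C \<ge> 0" "\<And>y z. y \<in> cball 0 (R + 2) - Omega2 f \<Longrightarrow> z \<in> cball 0 (R + 2) \<Longrightarrow>
     f y + grad f y \<bullet> (z - y) + 1 / 2 * ((z - y) \<bullet> (hessian f y *v (z - y)))
       \<le> f z + C * (norm (z - y))\<^sup>2"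
    using second_order_lower[of "R + 2"] by blast
  have "model f x \<epsilon> z \<le> f z + (9 * C) * \<epsilon>\<^sup>2"
    if x: "x \<in> cball 0 R" and \<epsilon>: "0 < \<epsilon>" "\<epsilon> \<le> 1" and z: "z \<in> cball x \<epsilon>" for x \<epsilon> z
  proof -
    have R: "cball x (2 * \<epsilon>) \<subseteq> cball 0 (R + 2)"
      using x \<epsilon> cball_subset_cball_iff[of x "2 * \<epsilon>" 0] by simp
    have bound: "f y + grad f y \<bullet> (z - y) + 1 / 2 * ((z - y) \<bullet> (hessian f y *v (z - y)))
        \<le> f z + (9 * C) * \<epsilon>\<^sup>2" if y: "y \<in> cball x (2 * \<epsilon>) - Omega2 f" for y
    proof -
      have "norm (z - y) \<le> 3 * \<epsilon>"
        using y z dist_triangle[of z y x] by (simp add: dist_commute dist_norm[symmetric])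
      then have "C * (norm (z - y))\<^sup>2 \<le> C * (3 * \<epsilon>)\<^sup>2"
        using C(1) by (intro mult_left_mono power_mono) auto
      moreover have "z \<in> cball x (2 * \<epsilon>)" using z \<epsilon> by simp
      then have "z \<in> cball 0 (R + 2)" using R by blast
      ultimately show ?thesis using C(2)[of y z] y R by (force simp: power2_eq_square)
    qed
    show ?thesis unfolding model_def
    proof (rule cSup_least)
      show "{f y + \<xi> \<bullet> (z - y) + 1 / 2 * ((z - y) \<bullet> (H *v (z - y))) |y \<xi> H.
          (y, f y, \<xi>, H) \<in> jet2 f x \<epsilon>} \<noteq> {}"
        using ex_mem_jet2[OF z] by blast
    qed (use jet2_le[OF \<epsilon>(1)] bound in blast)
  qed
  then show ?thesis using C(1) by (intro exI[of _ "9 * C"]) auto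
qed

end

subsection \<open>Critical points\<close>

text \<open>Writing the set of limits of gradients as a countable intersection of closures shows
  that it is closed, and \<open>B\<close> makes it bounded; in finite dimension the convex hull of a
  compact set is compact. Conversely, points chosen with both distances below
  \<open>1 / real (Suc n)\<close> recover a sequence from the intersection.\<close>

lemma compact_clarke_subdifferential:
  assumes B: "\<And>y. y \<in> ball x 1 \<Longrightarrow> f differentiable (at y) \<Longrightarrow> norm (grad f y) \<le> B"
  shows "compact (clarke_subdifferential f x)"
proof -
  let ?D = "\<lambda>n. {y \<in> ball x (1 / real (Suc n)). f differentiable (at y)}"
  have "{\<xi>. \<exists>y. (\<forall>i::nat. f differentiable (at (y i))) \<and> y \<longlonglongrightarrow> x \<and> (\<lambda>i. grad f (y i)) \<longlonglongrightarrow> \<xi>}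
     = (\<Inter>n. closure (grad f ` ?D n))" (is "?S = ?C")
  proof (intro equalityI subsetI)
    fix \<xi> assume "\<xi> \<in> ?S"
    then obtain y where y: "\<And>i::nat. f differentiable (at (y i))" "y \<longlonglongrightarrow> x"
      "(\<lambda>i. grad f (y i)) \<longlonglongrightarrow> \<xi>" by blast
    have "\<xi> \<in> closure (grad f ` ?D n)" for n
    proof (rule Lim_in_closed_set[OF _ _ _ y(3)])
      have "\<forall>\<^sub>F i in sequentially. dist (y i) x < 1 / real (Suc n)"
        by (rule tendstoD[OF y(2)]) simp
      then show "\<forall>\<^sub>F i in sequentially. grad f (y i) \<in> closure (grad f ` ?D n)"
      proof eventually_elim
        case (elim i)
        then have "grad f (y i) \<in> grad f ` ?D n" using y(1) by (simp add: dist_commute)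
        then show ?case by (rule subsetD[OF closure_subset])
      qed
    qed simp_all
    then show "\<xi> \<in> ?C" by blast
  next
    fix \<xi> assume \<xi>: "\<xi> \<in> ?C"
    have "\<exists>y. y \<in> ?D n \<and> dist (grad f y) \<xi> < 1 / real (Suc n)" for n
    proof -
      have "\<xi> \<in> closure (grad f ` ?D n)" using \<xi> by blast
      then have "\<forall>e>0. \<exists>y\<in>grad f ` ?D n. dist y \<xi> < e"
        by (simp only: closure_approachable)
      then have "\<exists>g\<in>grad f ` ?D n. dist g \<xi> < 1 / real (Suc n)"
        by (rule allE[of _ "1 / real (Suc n)"]) simp
      then show ?thesis by (elim bexE imageE) (rule exI, rule conjI, assumption, simp only:)
    qed
    then have "\<exists>y. \<forall>n. y n \<in> ?D n \<and> dist (grad f (y n)) \<xi> < 1 / real (Suc n)"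
      by (intro choice allI)
    then obtain y where "\<forall>n. y n \<in> ?D n \<and> dist (grad f (y n)) \<xi> < 1 / real (Suc n)" ..
    then have y: "\<And>n. y n \<in> ?D n" "\<And>n. dist (grad f (y n)) \<xi> < 1 / real (Suc n)"
      by simp_all
    have "y \<longlonglongrightarrow> x"
      using y(1) LIMSEQ_inverse_real_of_nat
      by (intro metric_tendsto_imp_tendsto[OF LIMSEQ_inverse_real_of_nat] always_eventually)
        (auto simp: dist_commute inverse_eq_divide less_imp_le)
    moreover have "(\<lambda>n. grad f (y n)) \<longlonglongrightarrow> \<xi>"
      using y(2)
      by (intro metric_tendsto_imp_tendsto[OF LIMSEQ_inverse_real_of_nat] always_eventually)
        (auto simp: inverse_eq_divide less_imp_le)
    ultimately show "\<xi> \<in> ?S" using y(1) by blast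
  qed
  moreover have "compact ?C"
  proof -
    have "grad f ` ?D 0 \<subseteq> cball 0 B" using B by auto
    then have "closure (grad f ` ?D 0) \<subseteq> cball 0 B" by (simp add: closure_minimal)
    then have "?C \<subseteq> cball 0 B" by blast
    then have "bounded ?C" using bounded_cball bounded_subset by blast
    moreover have "closed ?C" by (intro closed_INT ballI closed_closure)
    ultimately show ?thesis unfolding compact_eq_bounded_closed ..
  qed
  ultimately show ?thesis
    unfolding clarke_subdifferential_def by (simp add: compact_convex_hull)
qed

text \<open>A hyperplane strictly separates 0 from the closed convex subdifferential. The separation
  extends to gradients at nearby points: otherwise violating gradients would cluster at an element
  of the subdifferential on the wrong side.\<close>

lemma not_critical_ex_descent_direction:
  assumes B: "\<And>y. y \<in> ball x 1 \<Longrightarrow> f differentiable (at y) \<Longrightarrow> norm (grad f y) \<le> B"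
    and "\<not> critical f x"
  shows "\<exists>d c \<delta>. norm d = 1 \<and> c > 0 \<and> \<delta> > 0 \<and>
    (\<forall>y\<in>ball x \<delta>. f differentiable (at y) \<longrightarrow> grad f y \<bullet> d \<le> - c)"
proof -
  have "convex (clarke_subdifferential f x)"
    by (simp add: clarke_subdifferential_def)
  moreover have "closed (clarke_subdifferential f x)"
    using compact_clarke_subdifferential[OF B] by (simp add: compact_imp_closed)
  ultimately obtain a b where a: "a \<noteq> 0" "b > 0"
    "\<And>\<xi>. \<xi> \<in> clarke_subdifferential f x \<Longrightarrow> a \<bullet> \<xi> > b"
    using assms(2) separating_hyperplane_closed_0 unfolding critical_def by metis
  have "\<exists>\<delta>>0. \<forall>y\<in>ball x \<delta>. f differentiable (at y) \<longrightarrow> a \<bullet> grad f y \<ge> b" (is ?L)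
  proof (rule ccontr)
    assume "\<not> ?L"
    then have "\<exists>y. y \<in> ball x (1 / real (Suc n)) \<and> f differentiable (at y) \<and> a \<bullet> grad f y < b" for n
    proof -
      have "1 / real (Suc n) > 0" by simp
      then show ?thesis using \<open>\<not> ?L\<close> not_le by blast
    qed
    then have "\<exists>y. \<forall>n. y n \<in> ball x (1 / real (Suc n)) \<and> f differentiable (at (y n)) \<and> a \<bullet> grad f (y n) < b"
      by (intro choice allI)
    then obtain y where "\<forall>n. y n \<in> ball x (1 / real (Suc n)) \<and> f differentiable (at (y n)) \<and> a \<bullet> grad f (y n) < b" ..
    then have y: "\<And>n. y n \<in> ball x (1 / real (Suc n))"
      "\<And>n. f differentiable (at (y n))" "\<And>n. a \<bullet> grad f (y n) < b" by simp_all
    have lim: "y \<longlonglongrightarrow> x"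
      using y(1) LIMSEQ_inverse_real_of_nat
      by (intro metric_tendsto_imp_tendsto[OF LIMSEQ_inverse_real_of_nat] always_eventually)
        (auto simp: dist_commute inverse_eq_divide less_imp_le)
    have "y n \<in> ball x 1" for n
      using y(1)[of n] by (rule set_mp[OF subset_ball, rotated]) simp
    then have "bounded (range (\<lambda>n. grad f (y n)))"
      using B y(2) by (auto simp: bounded_iff)
    then obtain \<xi> r where r: "strict_mono (r :: nat \<Rightarrow> nat)" "((\<lambda>n. grad f (y n)) \<circ> r) \<longlonglongrightarrow> \<xi>"
      using bounded_imp_convergent_subsequence by blast
    then have r2: "(\<lambda>n. grad f (y (r n))) \<longlonglongrightarrow> \<xi>" by (simp add: o_def)
    have "(\<lambda>n. y (r n)) \<longlonglongrightarrow> x"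
      using LIMSEQ_subseq_LIMSEQ[OF lim r(1)] by (simp add: o_def)
    then have "\<xi> \<in> clarke_subdifferential f x"
      unfolding clarke_subdifferential_def using y(2) r2
      by (intro hull_inc) (auto intro!: exI[of _ "\<lambda>n. y (r n)"])
    moreover have "a \<bullet> \<xi> \<le> b"
      by (rule LIMSEQ_le_const2[OF tendsto_inner[OF tendsto_const r2]])
        (use y(3) less_imp_le in blast)
    ultimately show False using a(3) by fastforce
  qed
  then obtain \<delta> where \<delta>: "\<delta> > 0"
    "\<And>y. y \<in> ball x \<delta> \<Longrightarrow> f differentiable (at y) \<Longrightarrow> a \<bullet> grad f y \<ge> b" by blast
  \<comment> \<open>The descent direction is the negative of the separating normal, scaled to length
    1; the rate scales accordingly.\<close>
  have "grad f y \<bullet> (- (1 / norm a) *\<^sub>R a) \<le> - (b / norm a)"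
    if "y \<in> ball x \<delta>" "f differentiable (at y)" for y
    using \<delta>(2)[OF that] a(1) by (simp add: inner_commute divide_right_mono)
  then show ?thesis
    using a \<delta>(1) by (intro exI[of _ "- (1 / norm a) *\<^sub>R a"] exI[of _ "b / norm a"] exI[of _ \<delta>]) simp
qed

section \<open>Descent near points that are not critical\<close>

context weakly_convex
begin

text \<open>Since \<open>f\<close> may fail to be differentiable along the segment,
  \<open>lower\<close> takes the place of a mean value argument and is read backwards: its base
  points approach the target, and it is evaluated at \<open>x\<close>. Hence only the target has to
  lie in \<open>ball a \<delta>\<close>.\<close>

lemma descent_along_direction:
  assumes "\<forall>y\<in>ball a \<delta>. f differentiable (at y) \<longrightarrow> grad f y \<bullet> d \<le> - c" "norm d = 1"
  shows "\<exists>C\<ge>0. \<forall>x s. 0 < s \<longrightarrow> s \<le> 1 \<longrightarrow> x \<in> cball a 1 \<longrightarrow> x + s *\<^sub>R d \<in> ball a \<delta> \<longrightarrow>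
    f (x + s *\<^sub>R d) \<le> f x - c * s + C * s\<^sup>2"
proof -
  \<comment> \<open>The target has norm at most \<open>norm a + 2\<close>, so it is interior to this
    ball, and points close to it lie in the ball as well.\<close>
  define R where "R = norm a + 3"
  obtain C where C: "C \<ge> 0" "\<And>y z. y \<in> cball 0 R - Omega2 f \<Longrightarrow> z \<in> cball 0 R \<Longrightarrow>
      f y + grad f y \<bullet> (z - y) \<le> f z + C * (norm (z - y))\<^sup>2"
    using lower[of R] by blast
  obtain G where G: "\<And>y. y \<in> cball 0 R \<Longrightarrow> f differentiable (at y) \<Longrightarrow> norm (grad f y) \<le> G"
    using grad_bound[of R] by blast
  have "f (x + s *\<^sub>R d) \<le> f x - c * s + C * s\<^sup>2"
    if s: "0 < s" "s \<le> 1" and x: "x \<in> cball a 1" and z: "x + s *\<^sub>R d \<in> ball a \<delta>" for x s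
  proof -
    let ?z = "x + s *\<^sub>R d"
    obtain u where u: "\<And>k :: nat. u k \<notin> Omega2 f" "u \<longlonglongrightarrow> ?z" using ex_seq_not_Omega2[of "?z"] by blast
    have nx: "norm x \<le> norm a + 1"
      using x norm_triangle_sub[of x a] by (simp add: dist_norm norm_minus_commute)
    have "norm ?z \<le> norm a + 2"
      using nx norm_triangle_ineq[of x "s *\<^sub>R d"] assms(2) s by simp
    then have zR: "?z \<in> ball 0 R" by (simp add: R_def)
    have lim: "(\<lambda>k. f x + C * (norm (x - u k))\<^sup>2 + G * norm (?z - u k) - s * c) \<longlonglongrightarrow>
        f x + C * (norm (x - ?z))\<^sup>2 + G * norm (?z - ?z) - s * c"
      by (intro tendsto_intros u(2))
    have flim: "(\<lambda>k. f (u k)) \<longlonglongrightarrow> f ?z"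
      using cont u(2) by (auto intro: continuous_on_tendsto_compose)
    have "\<forall>\<^sub>F k in sequentially. u k \<in> ball 0 R" "\<forall>\<^sub>F k in sequentially. u k \<in> ball a \<delta>"
      using zR z u(2) topological_tendstoD open_ball by blast+
    then have "\<forall>\<^sub>F k in sequentially. f (u k) \<le> f x + C * (norm (x - u k))\<^sup>2 + G * norm (?z - u k) - s * c"
    proof eventually_elim
      case (elim k)
      have df: "f differentiable (at (u k))" using u(1) not_Omega2D(1) by blast
      have "f (u k) + grad f (u k) \<bullet> (x - u k) \<le> f x + C * (norm (x - u k))\<^sup>2"
        using elim u(1) nx by (intro C(2)) (auto simp: R_def)
      \<comment> \<open>The first summand vanishes in the limit by the bound on the gradients; the
        second yields the gain \<open>s * c\<close>.\<close>
      moreover have "grad f (u k) \<bullet> (x - u k) = grad f (u k) \<bullet> (?z - u k) - s * (grad f (u k) \<bullet> d)"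
        by (simp add: inner_diff_right inner_add_right)
      moreover have "s * (grad f (u k) \<bullet> d) \<le> s * (- c)"
        using assms(1) elim(2) df s by (intro mult_left_mono) auto
      moreover have "\<bar>grad f (u k) \<bullet> (?z - u k)\<bar> \<le> G * norm (?z - u k)"
        using G[of "u k"] elim(1) df
        by (intro order_trans[OF Cauchy_Schwarz_ineq2] mult_right_mono) auto
      ultimately show ?case by simp
    qed
    then have "f ?z \<le> f x + C * (norm (x - ?z))\<^sup>2 + G * norm (?z - ?z) - s * c"
      by (rule tendsto_le[OF _ lim flim, rotated]) simp
    then show ?thesis using assms(2) by (simp add: power_mult_distrib mult.commute)
  qed
  then show ?thesis using C(1) by blast
qed

text \<open>The step of length \<open>e k\<close> along a descent direction is feasible for the
  model. Comparing its model value with the stopping inequality and dividing by \<open>e k\<close>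
  bounds the rate \<open>c\<close> by a null sequence.\<close>

lemma critical_limit:
  assumes "is_minimizer_choice f zbar"
    and y: "y \<longlonglongrightarrow> a" and e: "e \<longlonglongrightarrow> 0" "\<And>k::nat. e k > 0" and t: "t \<longlonglongrightarrow> 0"
    and stop: "\<And>k. (\<theta> f zbar (y k) (e k) - f (y k)) / e k > - t k"
  shows "critical f a"
proof (rule ccontr)
  assume na: "\<not> critical f a"
  obtain G where G: "\<And>y. y \<in> cball 0 (norm a + 1) \<Longrightarrow> f differentiable (at y) \<Longrightarrow> norm (grad f y) \<le> G"
    using grad_bound[of "norm a + 1"] by blast
  have "ball a 1 \<subseteq> cball 0 (norm a + 1)"
    using ball_subset_cball_iff[of a 1 0 "norm a + 1"] by simp
  then obtain d c \<delta> where d: "norm d = 1" "c > 0" "\<delta> > 0"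
    and dc: "\<forall>y\<in>ball a \<delta>. f differentiable (at y) \<longrightarrow> grad f y \<bullet> d \<le> - c"
    using not_critical_ex_descent_direction[OF G na] by blast
  obtain C where C: "C \<ge> 0" "\<And>x s. 0 < s \<Longrightarrow> s \<le> 1 \<Longrightarrow> x \<in> cball a 1 \<Longrightarrow> x + s *\<^sub>R d \<in> ball a \<delta> \<Longrightarrow>
    f (x + s *\<^sub>R d) \<le> f x - c * s + C * s\<^sup>2"
    using descent_along_direction[OF dc d(1)] by blast
  obtain D where D: "D \<ge> 0" "\<And>x \<epsilon> z. x \<in> cball 0 (norm a + 1) \<Longrightarrow> 0 < \<epsilon> \<Longrightarrow> \<epsilon> \<le> 1 \<Longrightarrow>
      z \<in> cball x \<epsilon> \<Longrightarrow> model f x \<epsilon> z \<le> f z + D * \<epsilon>\<^sup>2"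
    using model_le[of "norm a + 1"] by blast
  have "(\<lambda>k. y k + e k *\<^sub>R d) \<longlonglongrightarrow> a + 0 *\<^sub>R d"
    by (intro tendsto_intros y e)
  then have "\<forall>\<^sub>F k in sequentially. y k + e k *\<^sub>R d \<in> ball a \<delta>"
    using d(3) by (intro topological_tendstoD) auto
  moreover have "\<forall>\<^sub>F k in sequentially. y k \<in> ball a 1"
    by (rule topological_tendstoD[OF y]) auto
  moreover have "\<forall>\<^sub>F k in sequentially. e k < 1"
    by (rule order_tendstoD(2)[OF e(1)]) simp
  ultimately have "\<forall>\<^sub>F k in sequentially. c \<le> t k + (C + D) * e k"
  proof eventually_elim
    case (elim k)
    let ?z = "y k + e k *\<^sub>R d"
    have z: "?z \<in> cball (y k) (e k)" using d(1) e(2)[of k] by (simp add: dist_norm)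
    have "\<theta> f zbar (y k) (e k) \<le> model f (y k) (e k) ?z"
      using assms(1) e(2) z unfolding is_minimizer_choice_def \<theta>_def is_arg_min_linorder by blast
    also have "\<dots> \<le> f ?z + D * (e k)\<^sup>2"
      using elim e(2) z \<open>ball a 1 \<subseteq> cball 0 (norm a + 1)\<close> by (intro D(2)) auto
    also have "f ?z \<le> f (y k) - c * e k + C * (e k)\<^sup>2"
      using elim e(2) by (intro C(2)) auto
    finally have "\<theta> f zbar (y k) (e k) - f (y k) \<le> - c * e k + (C + D) * (e k)\<^sup>2"
      by (simp add: algebra_simps)
    moreover have "- t k * e k < \<theta> f zbar (y k) (e k) - f (y k)"
      using stop[of k] e(2)[of k] by (simp add: pos_less_divide_eq)
    ultimately have "c * e k \<le> (t k + (C + D) * e k) * e k"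
      by (simp add: algebra_simps power2_eq_square)
    then show ?case using e(2)[of k] by simp
  qed
  then have "c \<le> 0 + (C + D) * 0"
    by (rule tendsto_lowerbound[rotated]) (simp, intro tendsto_intros t e)
  then show False using d(2) by simp
qed

end

subsection \<open>The descent method\<close>

context
  fixes f :: "real ^ 'n \<Rightarrow> real" and zbar :: "real ^ 'n \<Rightarrow> real \<Rightarrow> real ^ 'n"
    and \<epsilon> \<tau> :: "nat \<Rightarrow> real" and x0 :: "real ^ 'n"
begin

private abbreviation J :: "nat \<Rightarrow> nat" where "J l \<equiv> fst (run f zbar \<epsilon> \<tau> x0 l)"
private abbreviation X :: "nat \<Rightarrow> real ^ 'n" where "X \<equiv> all_iterates f zbar \<epsilon> \<tau> x0"
private abbreviation stopped :: "nat \<Rightarrow> bool" where "stopped l \<equiv> stops f zbar \<epsilon> \<tau> (J l) (X l)"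

lemma run_0: "run f zbar \<epsilon> \<tau> x0 0 = (1, 0, x0)"
  by (simp add: run_def)

lemma run_Suc: "run f zbar \<epsilon> \<tau> x0 (Suc l) = loop_pass f zbar \<epsilon> \<tau> (run f zbar \<epsilon> \<tau> x0 l)"
  by (simp add: run_def)

lemma J_Suc: "J (Suc l) = (if stopped l then Suc (J l) else J l)"
  by (cases "run f zbar \<epsilon> \<tau> x0 l") (simp add: run_Suc loop_pass_def all_iterates_def)

lemma X_Suc: "X (Suc l) = (if stopped l then X l else zbar (X l) (\<epsilon> (J l)))"
  by (cases "run f zbar \<epsilon> \<tau> x0 l") (simp add: run_Suc loop_pass_def all_iterates_def)

lemma J_mono: "l \<le> l' \<Longrightarrow> J l \<le> J l'"
  by (rule lift_Suc_mono_le[of J]) (simp_all add: J_Suc)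

lemma J_ge_1: "1 \<le> J l"
  using J_mono[of 0 l] by (simp add: run_0)

lemma J_less_after_stop:
  assumes "stopped l" "l < l'"
  shows "J l < J l'"
  using J_mono[of "Suc l" l'] assms by (simp add: J_Suc)

text \<open>The counter \<open>i\<close> records how many passes ago the present value of \<open>j\<close> was first reached.\<close>

lemma run_counter:
  "fst (snd (run f zbar \<epsilon> \<tau> x0 l)) \<le> l \<and>
   (\<forall>k \<le> l. J k = J l \<longleftrightarrow> l - fst (snd (run f zbar \<epsilon> \<tau> x0 l)) \<le> k)"
proof (induction l)
  case 0
  then show ?case by (simp add: run_0)
next
  case (Suc l)
  show ?case
  proof (cases "stopped l")
    case True
    then have "fst (snd (run f zbar \<epsilon> \<tau> x0 (Suc l))) = 0"
      by (cases "run f zbar \<epsilon> \<tau> x0 l") (simp add: run_Suc loop_pass_def all_iterates_def)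
    moreover have "J k \<noteq> J (Suc l)" if "k \<le> l" for k
      using J_mono[OF that] True by (simp add: J_Suc)
    ultimately show ?thesis by (auto simp: le_Suc_eq)
  next
    case False
    then have "fst (snd (run f zbar \<epsilon> \<tau> x0 (Suc l))) = Suc (fst (snd (run f zbar \<epsilon> \<tau> x0 l)))"
      by (cases "run f zbar \<epsilon> \<tau> x0 l") (simp add: run_Suc loop_pass_def all_iterates_def)
    moreover have "J (Suc l) = J l" using False by (simp add: J_Suc)
    ultimately show ?thesis using Suc.IH by (auto simp: le_Suc_eq)
  qed
qed

text \<open>By \<open>run_counter\<close> the passes with counter \<open>j\<close> begin at pass
  \<open>l - i\<close>, so \<open>j\<close> and \<open>i\<close> determine \<open>l\<close>. This is
  what makes the definite description in \<open>iterate\<close> proper.\<close>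

lemma run_inj:
  assumes "run f zbar \<epsilon> \<tau> x0 l = (j, i, x)" "run f zbar \<epsilon> \<tau> x0 l' = (j, i, x')"
  shows "l = l'"
proof -
  have *: "a \<le> b" if "run f zbar \<epsilon> \<tau> x0 a = (j, i, y)" "run f zbar \<epsilon> \<tau> x0 b = (j, i, y')" for a b y y'
  proof (rule ccontr)
    assume "\<not> a \<le> b"
    have b: "i \<le> b" "\<forall>k\<le>b. J k = j \<longleftrightarrow> b - i \<le> k"
      using run_counter[of b] that by auto
    have a: "i \<le> a" "\<forall>k\<le>a. J k = j \<longleftrightarrow> a - i \<le> k"
      using run_counter[of a] that by auto
    have "J (b - i) = j" using b by simp
    moreover have "b - i \<le> a" using \<open>\<not> a \<le> b\<close> by simp
    ultimately have "a - i \<le> b - i" using a(2) by blast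
    then show False using a(1) b(1) \<open>\<not> a \<le> b\<close> by simp
  qed
  show ?thesis using *[OF assms] *[OF assms(2,1)] by simp
qed

text \<open>A stop at pass \<open>l\<close> closes the block of passes with this value of
  \<open>j\<close>. By \<open>run_counter\<close> the rest of the block is the \<open>?i\<close>
  passes just before \<open>l\<close>, and none of them stops, since a stop would have raised
  \<open>j\<close>.\<close>

lemma descent_count_stopped:
  assumes "stopped l"
  shows "descent_count f zbar \<epsilon> \<tau> x0 (J l) = enat (fst (snd (run f zbar \<epsilon> \<tau> x0 l)))"
proof -
  let ?i = "fst (snd (run f zbar \<epsilon> \<tau> x0 l))"
  let ?D = "{k. \<exists>i x. run f zbar \<epsilon> \<tau> x0 k = (J l, i, x) \<and> \<not> stops f zbar \<epsilon> \<tau> (J l) x}"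
  have "?D = {l - ?i..<l}"
  proof (intro equalityI subsetI)
    fix k assume "k \<in> ?D"
    then have k: "J k = J l" "\<not> stopped k" by (auto simp: all_iterates_def)
    then have "\<not> l < k" "k \<noteq> l" using J_less_after_stop[OF assms, of k] assms by auto
    then show "k \<in> {l - ?i..<l}" using run_counter[of l] k(1) by force
  next
    fix k assume k: "k \<in> {l - ?i..<l}"
    then have "J k = J l" using run_counter[of l] by simp
    moreover from this have "\<not> stopped k" using J_less_after_stop[of k l] k by auto
    ultimately show "k \<in> ?D"
      by (intro CollectI exI[of _ "fst (snd (run f zbar \<epsilon> \<tau> x0 k))"] exI[of _ "X k"])
        (simp add: all_iterates_def prod_eq_iff)
  qed
  then show ?thesis
    using run_counter[of l] by (simp add: descent_count_def Let_def)
qed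

context
  assumes J_unbounded: "\<And>j. \<exists>l. J l > j"
begin

lemma ex_stopped:
  assumes "j \<ge> 1"
  shows "\<exists>l. J l = j \<and> stopped l"
proof -
  \<comment> \<open>The counter starts at 1 and rises only at a stop, and then by one; so the pass
    just before it first exceeds \<open>j\<close> is a stop at \<open>j\<close>.\<close>
  define L where "L = (LEAST l. J l > j)"
  have L: "J L > j" unfolding L_def by (rule LeastI_ex[OF J_unbounded])
  have "L \<noteq> 0"
  proof
    assume "L = 0"
    then show False using L assms by (simp add: run_0)
  qed
  then obtain l where l: "L = Suc l" using not0_implies_Suc by blast
  have "\<not> J l > j" using l not_less_Least[of l "\<lambda>l. J l > j"] by (simp add: L_def)
  then have "J l = j \<and> stopped l" using L l by (auto simp: J_Suc split: if_splits)
  then show ?thesis ..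
qed

text \<open>Each value up to \<open>J l\<close> has its own stopping pass, so all counts tested by
  \<open>outer_iterate\<close> are finite; \<open>run_inj\<close> then identifies the
  iterate.\<close>

lemma outer_iterate_stopped:
  assumes "stopped l"
  shows "outer_iterate f zbar \<epsilon> \<tau> x0 (J l) = Some (X l)"
proof -
  have "descent_count f zbar \<epsilon> \<tau> x0 k \<noteq> \<infinity>" if "k \<in> {1..J l}" for k
    using ex_stopped[of k] that descent_count_stopped by fastforce
  moreover have "iterate f zbar \<epsilon> \<tau> x0 (J l) (fst (snd (run f zbar \<epsilon> \<tau> x0 l))) = X l"
    unfolding iterate_def
  proof (rule the_equality)
    show "\<exists>k. run f zbar \<epsilon> \<tau> x0 k = (J l, fst (snd (run f zbar \<epsilon> \<tau> x0 l)), X l)"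
      by (intro exI[of _ l]) (simp add: all_iterates_def)
  next
    fix x assume "\<exists>k. run f zbar \<epsilon> \<tau> x0 k = (J l, fst (snd (run f zbar \<epsilon> \<tau> x0 l)), x)"
    then obtain k where k: "run f zbar \<epsilon> \<tau> x0 k = (J l, fst (snd (run f zbar \<epsilon> \<tau> x0 l)), x)" ..
    then have "k = l" by (rule run_inj) (simp add: prod_eq_iff)
    then show "x = X l" using arg_cong[OF k, of "\<lambda>p. snd (snd p)"] by (simp add: all_iterates_def)
  qed
  ultimately show ?thesis
    using J_ge_1[of l] descent_count_stopped[OF assms] by (simp add: outer_iterate_def)
qed

lemma outer_iterateE:
  assumes "j \<ge> 1"
  obtains l where "J l = j" "stopped l" "outer_iterate f zbar \<epsilon> \<tau> x0 j = Some (X l)"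
  using ex_stopped[OF assms] outer_iterate_stopped by metis

end

end

section \<open>Convergence of the method for weakly convex functions\<close>

theorem (in weakly_convex) descent_method_convergence:
  assumes \<epsilon>: "\<And>j. j \<ge> 1 \<Longrightarrow> \<epsilon> j > 0" "\<epsilon> \<longlonglongrightarrow> 0"
    and \<tau>: "\<And>j. j \<ge> 1 \<Longrightarrow> \<tau> j > 0" "\<tau> \<longlonglongrightarrow> 0"
    and zbar: "is_minimizer_choice f zbar"
    and level: "bounded {y. f y \<le> f x0}"
  shows "(\<exists>a. accumulation_point (outer_iterate f zbar \<epsilon> \<tau> x0) a) \<and>
         (\<forall>a. accumulation_point (outer_iterate f zbar \<epsilon> \<tau> x0) a \<longrightarrow>
            critical f a \<and> (\<lambda>l. f (all_iterates f zbar \<epsilon> \<tau> x0 l)) \<longlonglongrightarrow> f a)"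
proof -
  let ?J = "\<lambda>l. fst (run f zbar \<epsilon> \<tau> x0 l)"
  let ?X = "all_iterates f zbar \<epsilon> \<tau> x0"
  let ?stopped = "\<lambda>l. stops f zbar \<epsilon> \<tau> (?J l) (?X l)"
  let ?K = "{y. f y \<le> f x0}"
  have decrease: "f (?X (Suc l)) \<le> f (?X l) - \<tau> (?J l) * \<epsilon> (?J l)" if "\<not> ?stopped l" for l
  proof -
    have e: "\<epsilon> (?J l) > 0" by (rule \<epsilon>(1)[OF J_ge_1])
    have z: "zbar (?X l) (\<epsilon> (?J l)) \<in> cball (?X l) (\<epsilon> (?J l))"
      using zbar e unfolding is_minimizer_choice_def is_arg_min_linorder by blast
    have "f (?X (Suc l)) \<le> \<theta> f zbar (?X l) (\<epsilon> (?J l))"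
      using model_ge[OF e z] that by (simp add: X_Suc \<theta>_def)
    also have "\<dots> \<le> f (?X l) - \<tau> (?J l) * \<epsilon> (?J l)"
      using that e by (simp add: stops_def not_less pos_divide_le_eq)
    finally show ?thesis .
  qed
  have mono: "f (?X (Suc l)) \<le> f (?X l)" for l
  proof (cases "?stopped l")
    case False
    have "\<tau> (?J l) * \<epsilon> (?J l) > 0" by (intro mult_pos_pos \<tau>(1) \<epsilon>(1) J_ge_1)
    then show ?thesis using decrease[OF False] by simp
  qed (simp add: X_Suc)
  then have dec: "decseq (\<lambda>l. f (?X l))" by (rule decseq_SucI)
  have inK: "?X l \<in> ?K" for l
    using decseqD[OF dec, of 0 l] by (simp add: all_iterates_def run_0)
  have "closed ?K" by (intro closed_Collect_le cont continuous_on_const)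
  with level have K: "compact ?K" by (simp add: compact_eq_bounded_closed)
  have "compact (f ` ?K)" using K cont continuous_on_subset by (intro compact_continuous_image) auto
  then obtain m where m: "\<And>y. y \<in> ?K \<Longrightarrow> m \<le> f y"
    using bounded_imp_bdd_below[OF compact_imp_bounded] by (fastforce simp: bdd_below_def)
  have "\<forall>l. m \<le> f (?X l)" using m inK by blast
  then obtain v where v: "(\<lambda>l. f (?X l)) \<longlonglongrightarrow> v"
    using decseq_convergent[OF dec] by metis
  \<comment> \<open>If the counter stayed bounded, it would be constant from some pass on. All later
    passes would then be descent steps with the same guaranteed decrease \<open>c\<close>, against
    the convergence of the values.\<close>
  have unbounded: "\<exists>l. ?J l > j" for j
  proof (rule ccontr)
    assume "\<not> ?thesis"
    then have "finite (range ?J)" unfolding finite_nat_set_iff_bounded_le by (auto simp: not_less)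
    then have "Max (range ?J) \<in> range ?J" by (intro Max_in) auto
    then obtain L where L: "?J L = Max (range ?J)" by auto
    have J: "?J l = ?J L" if "l \<ge> L" for l
      using J_mono[OF that, of f zbar \<epsilon> \<tau> x0] L Max_ge[OF \<open>finite (range ?J)\<close>, of "?J l"] by simp
    define c where "c = \<tau> (?J L) * \<epsilon> (?J L)"
    have c: "c > 0" unfolding c_def by (intro mult_pos_pos \<tau>(1) \<epsilon>(1) J_ge_1)
    have step: "f (?X (Suc l)) \<le> f (?X l) - c" if "l \<ge> L" for l
    proof -
      have "?J (Suc l) = ?J l" using J[of l] J[of "Suc l"] that by simp
      then have "\<not> ?stopped l" by (auto simp: J_Suc)
      then show ?thesis using decrease[of l] J[OF that] by (simp add: c_def)
    qed
    have "(\<lambda>l. f (?X (Suc l)) - f (?X l)) \<longlonglongrightarrow> v - v"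
      by (intro tendsto_diff v LIMSEQ_Suc)
    then have "v - v \<le> - c"
      by (rule LIMSEQ_le_const2) (use step in \<open>force intro!: exI[of _ L]\<close>)
    then show False using c by simp
  qed
  have "\<exists>l. outer_iterate f zbar \<epsilon> \<tau> x0 (Suc k) = Some (?X l)" for k
    by (rule outer_iterateE[OF unbounded, of "Suc k"]) auto
  \<comment> \<open>The shift by \<open>Suc\<close> skips index 0, where
    \<open>outer_iterate\<close> is \<open>None\<close>.\<close>
  then obtain q where q: "\<And>k. outer_iterate f zbar \<epsilon> \<tau> x0 (Suc k) = Some (?X (q k))" by metis
  obtain a r where "strict_mono (r :: nat \<Rightarrow> nat)" "((\<lambda>k. ?X (q k)) \<circ> r) \<longlonglongrightarrow> a"
    using K[unfolded compact_def, rule_format, of "\<lambda>k. ?X (q k)"] inK by blast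
  then have "accumulation_point (outer_iterate f zbar \<epsilon> \<tau> x0) a"
    unfolding accumulation_point_def using q
    by (intro exI[of _ "\<lambda>k. Suc (r k)"] exI[of _ "\<lambda>k. ?X (q (r k))"]) (simp add: strict_mono_def o_def)
  moreover have "critical f a \<and> (\<lambda>l. f (?X l)) \<longlonglongrightarrow> f a"
    if acc: "accumulation_point (outer_iterate f zbar \<epsilon> \<tau> x0) a" for a
  proof -
    obtain r y where r: "strict_mono r" "\<And>k. outer_iterate f zbar \<epsilon> \<tau> x0 (r k) = Some (y k)"
      and y: "y \<longlonglongrightarrow> a"
      using acc unfolding accumulation_point_def by blast
    have r1: "r k \<ge> 1" for k
      using r(2)[of k] by (simp add: outer_iterate_def split: if_splits)
    have "\<exists>l. ?J l = r k \<and> ?stopped l \<and> ?X l = y k" for k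
      by (rule outer_iterateE[OF unbounded r1[of k]]) (use r(2)[of k] in force)
    then obtain p where p: "\<And>k. ?J (p k) = r k" "\<And>k. ?stopped (p k)" "\<And>k. ?X (p k) = y k"
      by metis
    have "critical f a"
    proof (rule critical_limit[OF zbar y])
      show "(\<lambda>k. \<epsilon> (r k)) \<longlonglongrightarrow> 0" "(\<lambda>k. \<tau> (r k)) \<longlonglongrightarrow> 0"
        using LIMSEQ_subseq_LIMSEQ[OF \<epsilon>(2) r(1)] LIMSEQ_subseq_LIMSEQ[OF \<tau>(2) r(1)]
        by (simp_all add: o_def)
      show "\<epsilon> (r k) > 0" for k by (rule \<epsilon>(1)[OF r1])
      show "(\<theta> f zbar (y k) (\<epsilon> (r k)) - f (y k)) / \<epsilon> (r k) > - \<tau> (r k)" for k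
        using p[of k] by (simp add: stops_def)
    qed
    \<comment> \<open>The counter is monotone and its values \<open>r k\<close> increase strictly,
      so the selected stops occur in increasing order. Thus \<open>f (y k)\<close> is a subsequence
      of all values, and every accumulation point has the same value \<open>v\<close>.\<close>
    moreover have "strict_mono p"
    proof (rule strict_monoI, rule ccontr)
      fix k l :: nat assume "k < l" "\<not> p k < p l"
      then show False
        using J_mono[of "p l" "p k" f zbar \<epsilon> \<tau> x0] strict_monoD[OF r(1), of k l] p(1)[of k] p(1)[of l] by simp
    qed
    then have "(\<lambda>k. f (y k)) \<longlonglongrightarrow> v"
      using LIMSEQ_subseq_LIMSEQ[OF v \<open>strict_mono p\<close>] p(3) by (simp add: o_def)
    then have "v = f a"
      using continuous_on_tendsto_compose[OF cont y] LIMSEQ_unique by auto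
    ultimately show ?thesis using v by simp
  qed
  ultimately show ?thesis by blast
qed

subsection \<open>Convex functions\<close>

lemma DERIV_along_line:
  assumes "f differentiable (at (y + t *\<^sub>R v))"
  shows "((\<lambda>s. f (y + s *\<^sub>R v)) has_real_derivative grad f (y + t *\<^sub>R v) \<bullet> v) (at t)"
proof -
  have "((\<lambda>s. y + s *\<^sub>R v) has_derivative (\<lambda>h. h *\<^sub>R v)) (at t)"
    by (auto intro!: derivative_eq_intros)
  moreover have "(f has_derivative (\<lambda>h. h \<bullet> grad f (y + t *\<^sub>R v))) (at (y + t *\<^sub>R v))"
    using GDERIV_grad[OF assms] by (simp add: gderiv_def)
  ultimately have "((\<lambda>s. f (y + s *\<^sub>R v)) has_derivative (\<lambda>h. (h *\<^sub>R v) \<bullet> grad f (y + t *\<^sub>R v))) (at t)"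
    by (rule has_derivative_compose)
  then show ?thesis
    by (simp add: has_field_derivative_def inner_commute mult.commute[of _ "_ \<bullet> _"])
qed

text \<open>Restriction to the line through \<open>y\<close> and \<open>z\<close> reduces this to
  the tangent inequality in one variable, with tangent at 0 and evaluation at 1.\<close>

lemma convex_on_above_tangent:
  fixes f :: "real ^ 'n \<Rightarrow> real"
  assumes "convex_on UNIV f" "f differentiable (at y)"
  shows "f y + grad f y \<bullet> (z - y) \<le> f z"
proof -
  have "convex_on UNIV (\<lambda>s. f (y + s *\<^sub>R (z - y)))"
  proof (rule convex_onI)
    fix t a b :: real assume "0 < t" "t < 1"
    moreover have "y + ((1 - t) *\<^sub>R a + t *\<^sub>R b) *\<^sub>R (z - y)
        = (1 - t) *\<^sub>R (y + a *\<^sub>R (z - y)) + t *\<^sub>R (y + b *\<^sub>R (z - y))"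
      by (simp add: algebra_simps)
    ultimately show "f (y + ((1 - t) *\<^sub>R a + t *\<^sub>R b) *\<^sub>R (z - y))
        \<le> (1 - t) * f (y + a *\<^sub>R (z - y)) + t * f (y + b *\<^sub>R (z - y))"
      using convex_onD[OF assms(1), of t "y + a *\<^sub>R (z - y)" "y + b *\<^sub>R (z - y)"] by simp
  qed simp
  from convex_on_imp_above_tangent[OF this connected_UNIV, of 0 1 "grad f y \<bullet> (z - y)"]
  show ?thesis using DERIV_along_line[of f y 0 "z - y"] assms(2) by simp
qed

lemma bounded_image_compact:
  assumes "compact K" "\<And>x. x \<in> K \<Longrightarrow> \<exists>V. open V \<and> x \<in> V \<and> bounded (g ` (V - S))"
  shows "bounded (g ` (K - S))"
proof -
  let ?P = "\<lambda>x V. open V \<and> x \<in> V \<and> bounded (g ` (V - S))"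
  have "\<forall>x\<in>K. \<exists>V. ?P x V" using assms(2) by blast
  then obtain V where V: "\<forall>x\<in>K. ?P x (V x)" by (rule bchoice[THEN exE])
  then have "\<And>x. x \<in> K \<Longrightarrow> open (V x)" "K \<subseteq> (\<Union>x\<in>K. V x)" by auto
  then obtain K' where K': "K' \<subseteq> K" "finite K'" "K \<subseteq> (\<Union>x\<in>K'. V x)"
    using compactE_image[OF assms(1)] by meson
  have "bounded (\<Union>x\<in>K'. g ` (V x - S))"
    using K' V by (intro bounded_UN) auto
  then show ?thesis
    by (rule bounded_subset) (use K'(3) in blast)
qed

lemma weakly_convexI_convex:
  fixes f :: "real ^ 'n \<Rightarrow> real"
  assumes f: "convex_on UNIV f"
    and null: "Omega2 f \<in> null_sets lebesgue"
    and hess: "\<And>x. \<exists>V. open V \<and> x \<in> V \<and> bounded (hessian f ` (V - Omega2 f))"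
  shows "weakly_convex f"
proof
  show cont: "continuous_on UNIV f" using f by (intro convex_on_continuous) auto
  \<comment> \<open>A nonempty open set is not negligible, so a null set has dense
    complement.\<close>
  have "interior (Omega2 f) = {}"
    using null negligible_iff_null_sets[of "Omega2 f"] negligible_subset[OF _ interior_subset, of "Omega2 f"]
      open_not_negligible[OF open_interior, of "Omega2 f"] by blast
  then show "closure (- Omega2 f) = UNIV" by (simp add: closure_complement)
  show "\<exists>C. \<forall>y\<in>cball 0 R. f differentiable (at y) \<longrightarrow> norm (grad f y) \<le> C" for R
  proof -
    have "bounded (f ` cball 0 (R + 1))"
      using cont continuous_on_subset compact_continuous_image compact_imp_bounded compact_cball
      by (metis subset_UNIV)
    then obtain M where M: "\<And>y. y \<in> cball 0 (R + 1) \<Longrightarrow> \<bar>f y\<bar> \<le> M"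
      unfolding bounded_iff by force
    \<comment> \<open>The tangent inequality is tested with a step along the normalized gradient.
      The linear gain is exactly the norm of the gradient, and it is at most the oscillation of
      \<open>f\<close> on the larger ball.\<close>
    have "norm (grad f y) \<le> 2 * M" if y: "y \<in> cball 0 R" "f differentiable (at y)" for y
    proof -
      have "norm (sgn (grad f y)) \<le> 1" by (simp add: norm_sgn)
      then have "y + sgn (grad f y) \<in> cball 0 (R + 1)" "y \<in> cball 0 (R + 1)"
        using y norm_triangle_ineq[of y "sgn (grad f y)"] by auto
      then have "\<bar>f y\<bar> \<le> M" "\<bar>f (y + sgn (grad f y))\<bar> \<le> M" using M by blast+
      moreover have "grad f y \<bullet> sgn (grad f y) = norm (grad f y)"
        by (cases "grad f y = 0")
          (simp_all add: sgn_div_norm power2_norm_eq_inner[symmetric] power2_eq_square)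
      ultimately show ?thesis
        using convex_on_above_tangent[OF f y(2), of "y + sgn (grad f y)"] by simp
    qed
    then show ?thesis by blast
  qed
  show "bounded (hessian f ` (cball 0 R - Omega2 f))" for R
    using hess by (intro bounded_image_compact) auto
  show "\<exists>C\<ge>0. \<forall>y\<in>cball 0 R - Omega2 f. \<forall>z\<in>cball 0 R.
      f y + grad f y \<bullet> (z - y) \<le> f z + C * (norm (z - y))\<^sup>2" for R
    using convex_on_above_tangent[OF f] not_Omega2D(1)[of _ f] by (intro exI[of _ 0]) auto
qed

subsection \<open>Functions of max-type\<close>

text \<open>Differentiability of a vector field is componentwise, and the rows of the Hessian are
  the gradients of the components of the gradient. Its entries are thus second partial derivatives,
  which the third level of \<open>Ck_on\<close> makes differentiable and so continuous.\<close>

lemma Ck_on_3D: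
  fixes F :: "real ^ 'n \<Rightarrow> real"
  assumes "Ck_on 3 UNIV F"
  shows "F differentiable (at x)" "grad F differentiable (at x)" "continuous_on UNIV (hessian F)"
proof -
  have 1: "F differentiable (at x)" "(\<lambda>x. grad F x $ i) differentiable (at x)"
    "(\<lambda>x. grad (\<lambda>x. grad F x $ i) x $ j) differentiable (at x)" for i j x
    using assms by (simp_all add: numeral_3_eq_3)
  show "F differentiable (at x)" by (rule 1)
  have 2: "grad F differentiable (at x)" for x
    using 1(2) by (subst differentiable_componentwise_within)
      (auto simp: Basis_vec_def cart_eq_inner_axis[symmetric])
  then show "grad F differentiable (at x)" .
  have "hessian F x $ i = grad (\<lambda>x. grad F x $ i) x" for x i
  proof (rule grad_eq[symmetric])
    have "(grad F has_derivative (*v) (hessian F x)) (at x)"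
      using 2 unfolding hessian_def jacobian_works .
    from bounded_linear.has_derivative[OF bounded_linear_vec_nth this]
    show "GDERIV (\<lambda>x. grad F x $ i) x :> hessian F x $ i"
      by (simp add: gderiv_def matrix_vector_mul_component inner_commute)
  qed
  then have "hessian F = (\<lambda>x. \<chi> i j. grad (\<lambda>x. grad F x $ i) x $ j)"
    by (intro ext) (simp add: vec_eq_iff)
  moreover have "continuous_on UNIV (\<lambda>x. grad (\<lambda>x. grad F x $ i) x $ j)" for i j
    using 1(3) differentiable_imp_continuous_on differentiable_on_def by (metis UNIV_I differentiable_at_withinI)
  ultimately show "continuous_on UNIV (hessian F)"
    by (simp only: continuous_on_vec_lambda)
qed

text \<open>A continuous Hessian is bounded on the ball, which makes the gradient Lipschitz there.
  The mean value theorem expresses the increment by the gradient at an intermediate point, which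
  convexity keeps in the ball; moving that gradient back to \<open>y\<close> costs a quadratic
  error.\<close>

lemma quadratic_lower_bound:
  fixes F :: "real ^ 'n \<Rightarrow> real"
  assumes F: "\<And>x. F differentiable (at x)" "\<And>x. grad F differentiable (at x)"
    "continuous_on UNIV (hessian F)"
  shows "\<exists>C\<ge>0. \<forall>y\<in>cball 0 R. \<forall>z\<in>cball 0 R. F y + grad F y \<bullet> (z - y) \<le> F z + C * (norm (z - y))\<^sup>2"
proof -
  have "compact (hessian F ` cball 0 R)"
    using F(3) continuous_on_subset by (intro compact_continuous_image) auto
  then obtain B where B: "B > 0" "\<And>x. x \<in> cball 0 R \<Longrightarrow> norm (hessian F x) \<le> B"
    using compact_imp_bounded[of "hessian F ` cball 0 R"] unfolding bounded_pos by fast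
  define C where "C = (real CARD('n))\<^sup>2 * B"
  have C: "C \<ge> 0" using B(1) by (simp add: C_def)
  have lip: "norm (grad F w - grad F y) \<le> C * norm (w - y)" if "w \<in> cball 0 R" "y \<in> cball 0 R" for w y
  proof (rule differentiable_bound[OF convex_cball _ _ that])
    show "(grad F has_derivative (*v) (hessian F x)) (at x within cball 0 R)" for x
      using F(2)[of x] has_derivative_at_withinI unfolding hessian_def jacobian_works by blast
    show "onorm ((*v) (hessian F x)) \<le> C" if "x \<in> cball 0 R" for x
      unfolding C_def using B(2)[OF that]
      by (intro order_trans[OF onorm_matrix_le] mult_left_mono) auto
  qed
  have "F y + grad F y \<bullet> (z - y) \<le> F z + C * (norm (z - y))\<^sup>2"
    if y: "y \<in> cball 0 R" and z: "z \<in> cball 0 R" for y z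
  proof -
    have "\<exists>t::real. 0 < t \<and> t < 1 \<and> F (y + 1 *\<^sub>R (z - y)) - F (y + 0 *\<^sub>R (z - y))
        = (1 - 0) * (grad F (y + t *\<^sub>R (z - y)) \<bullet> (z - y))"
      by (rule MVT2) (use F(1) in \<open>auto intro: DERIV_along_line\<close>)
    then obtain t :: real where t: "0 < t" "t < 1" "F z - F y = grad F (y + t *\<^sub>R (z - y)) \<bullet> (z - y)"
      by auto
    let ?w = "y + t *\<^sub>R (z - y)"
    have "?w = (1 - t) *\<^sub>R y + t *\<^sub>R z" by (simp add: algebra_simps)
    then have w: "?w \<in> cball 0 R"
      using convexD_alt[OF convex_cball y z, of t] t by simp
    have "(grad F y - grad F ?w) \<bullet> (z - y) \<le> norm (grad F y - grad F ?w) * norm (z - y)"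
      by (rule norm_cauchy_schwarz)
    also have "\<dots> \<le> C * norm (y - ?w) * norm (z - y)"
      by (intro mult_right_mono lip y w) simp
    also have "norm (y - ?w) \<le> norm (z - y)"
      using t by (simp add: mult_left_le_one_le)
    then have "C * norm (y - ?w) * norm (z - y) \<le> C * norm (z - y) * norm (z - y)"
      using C by (intro mult_right_mono mult_left_mono) auto
    finally show ?thesis
      using t(3) by (simp add: inner_diff_left power2_eq_square)
  qed
  then show ?thesis using C by blast
qed

text \<open>The difference \<open>f x - F x\<close> is minimal at \<open>y\<close>, so its
  derivative vanishes there.\<close>

lemma grad_eq_touching:
  assumes "f differentiable (at y)" "F differentiable (at y)" "F y = f y" "\<And>x. F x \<le> f x"
  shows "grad f y = grad F y"
proof -
  have "((\<lambda>x. f x - F x) has_derivative (\<lambda>h. h \<bullet> (grad f y - grad F y))) (at y)"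
    using GDERIV_grad[OF assms(1)] GDERIV_grad[OF assms(2)] GDERIV_diff
    by (fastforce simp: gderiv_def)
  moreover have "\<forall>\<^sub>F x in at y. f y - F y \<le> f x - F x"
    using assms(3,4) by simp
  ultimately have "(\<lambda>h. h \<bullet> (grad f y - grad F y)) = (\<lambda>h. 0)"
    by (rule has_derivative_local_min)
  then have "(grad f y - grad F y) \<bullet> (grad f y - grad F y) = 0" by meson
  then show ?thesis by simp
qed

text \<open>At a zero of \<open>g\<close> other than \<open>t\<close> the remainder quotient equals
  \<open>norm w\<close>. As this quotient tends to 0, zeros clustering at \<open>t\<close> force
  \<open>w = 0\<close>.\<close>

lemma has_vector_derivative_zero_if_frequently_zero:
  fixes g :: "real \<Rightarrow> 'a::real_normed_vector"
  assumes "(g has_vector_derivative w) (at t within S)" "g t = 0" "\<exists>\<^sub>F s in at t within S. g s = 0"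
  shows "w = 0"
proof (rule ccontr)
  assume "w \<noteq> 0"
  have "((\<lambda>s. norm ((g s - g t) - (s - t) *\<^sub>R w) / norm (s - t)) \<longlongrightarrow> 0) (at t within S)"
    using assms(1) unfolding has_vector_derivative_def has_derivative_iff_norm by blast
  then have "\<forall>\<^sub>F s in at t within S. norm ((g s - g t) - (s - t) *\<^sub>R w) / norm (s - t) \<noteq> norm w"
    by (rule tendsto_imp_eventually_ne) (use \<open>w \<noteq> 0\<close> in simp)
  moreover have "\<forall>\<^sub>F s in at t within S. s \<noteq> t"
    by (simp add: eventually_at_filter)
  ultimately have "\<forall>\<^sub>F s in at t within S. g s \<noteq> 0"
    by eventually_elim (use assms(2) in auto)
  then show False using assms(3) by (simp add: frequently_def)
qed

lemma not_Omega2_if_eventually_eq: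
  assumes "\<forall>\<^sub>F y in nhds x. f y = F y" "\<And>x. F differentiable (at x)" "\<And>x. grad F differentiable (at x)"
  shows "x \<notin> Omega2 f"
proof -
  obtain U where U: "open U" "x \<in> U" "\<And>y. y \<in> U \<Longrightarrow> f y = F y"
    using assms(1) by (auto simp: eventually_nhds)
  have G: "GDERIV f y :> grad F y" if "y \<in> U" for y
    using GDERIV_grad[OF assms(2)[of y]] has_derivative_transform_within_open[OF _ U(1) that, of F _ UNIV f] U(3)
    unfolding gderiv_def by force
  have "\<forall>\<^sub>F y in nhds x. f differentiable (at y)"
    using U(1,2) G by (auto simp: eventually_nhds gderiv_def differentiable_def)
  moreover have "grad f differentiable (at x)"
  proof -
    obtain D where "(grad F has_derivative D) (at x)"
      using assms(3) by (auto simp: differentiable_def)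
    then have "(grad f has_derivative D) (at x)"
      by (rule has_derivative_transform_within_open[OF _ U(1,2)]) (use G grad_eq in metis)
    then show ?thesis by (auto simp: differentiable_def)
  qed
  ultimately show ?thesis by (simp add: Omega2_def twice_differentiable_at_def)
qed

section \<open>Finite maxima: active pieces, Hessians and density of smooth points\<close>

locale C2_max =
  fixes f :: "real ^ 'n \<Rightarrow> real" and I :: "'i set" and F :: "'i \<Rightarrow> real ^ 'n \<Rightarrow> real"
  assumes finite_I: "finite I" and I_nonempty: "I \<noteq> {}"
    and f_eq: "\<And>x. f x = Max ((\<lambda>k. F k x) ` I)"
    and diff: "\<And>k x. k \<in> I \<Longrightarrow> F k differentiable (at x)"
    and grad_diff: "\<And>k x. k \<in> I \<Longrightarrow> grad (F k) differentiable (at x)"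
    and hess_cont: "\<And>k. k \<in> I \<Longrightarrow> continuous_on UNIV (hessian (F k))"
begin

lemma F_le: "k \<in> I \<Longrightarrow> F k x \<le> f x"
  using finite_I by (simp add: f_eq)

lemma ex_active: "\<exists>k\<in>I. F k x = f x"
proof -
  have "f x \<in> (\<lambda>k. F k x) ` I"
    unfolding f_eq using finite_I I_nonempty by (intro Max_in) auto
  then show ?thesis by auto
qed

lemma F_cont: "k \<in> I \<Longrightarrow> continuous_on UNIV (F k)"
  using diff differentiable_imp_continuous_on differentiable_on_def differentiable_at_withinI by metis

lemma grad_cont: "k \<in> I \<Longrightarrow> continuous_on UNIV (grad (F k))"
  using grad_diff differentiable_imp_continuous_on differentiable_on_def differentiable_at_withinI by metis

lemma f_cont: "continuous_on UNIV f"
proof -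
  have "continuous_on UNIV (\<lambda>x. Max ((\<lambda>k. F k x) ` I))"
    using finite_I I_nonempty F_cont
  proof (induction I rule: finite_ne_induct)
    case (insert k I)
    then have "continuous_on UNIV (\<lambda>x. max (F k x) (Max ((\<lambda>k. F k x) ` I)))"
      by (intro continuous_on_max) auto
    then show ?case using insert.hyps by simp
  qed simp
  then show ?thesis by (simp add: f_eq[abs_def])
qed

lemma grad_active:
  assumes "f differentiable (at y)" "k \<in> I" "F k y = f y"
  shows "grad f y = grad (F k) y"
  using assms diff F_le by (intro grad_eq_touching) auto

text \<open>Along a ray from \<open>y\<close> some index is active arbitrarily close to \<open>y\<close>, and where it is active
  the gradients agree.\<close>

lemma hessian_mult_active:
  assumes y: "y \<notin> Omega2 f"
  shows "\<exists>k\<in>I. hessian f y *v v = hessian (F k) y *v v"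
proof -
  let ?p = "\<lambda>s::real. y + s *\<^sub>R v"
  have p: "(?p \<longlongrightarrow> y) (at_right 0)"
    by (rule tendsto_eq_intros refl | simp)+
  have "\<exists>k\<in>I. \<exists>\<^sub>F s in at_right 0. F k (?p s) = f (?p s)"
    using ex_active by (intro frequently_bex_finite finite_I) (simp add: eventually_frequently)
  \<comment> \<open>Finiteness of \<open>I\<close> yields one index that is active for arbitrarily
    small \<open>s\<close>. It may depend on \<open>v\<close>, which is why only the product with
    \<open>v\<close> is compared.\<close>
  then obtain k where k: "k \<in> I" "\<exists>\<^sub>F s in at_right 0. F k (?p s) = f (?p s)" ..
  have "\<forall>\<^sub>F s in at_right 0. f differentiable (at (?p s))"
    using not_Omega2D(3)[OF y] p by (auto simp: filterlim_iff)
  with k(2) have fr: "\<exists>\<^sub>F s in at_right 0. grad f (?p s) - grad (F k) (?p s) = 0"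
    by (rule frequently_rev_mp[OF frequently_eventually_frequently])
      (use grad_active[OF _ k(1)] in \<open>auto intro!: always_eventually\<close>)
  \<comment> \<open>By continuity, a positive gap between \<open>f\<close> and \<open>F k\<close> at
    \<open>y\<close> would persist along the ray for small \<open>s\<close>.\<close>
  have act: "F k y = f y"
  proof (rule ccontr)
    assume "F k y \<noteq> f y"
    have "((\<lambda>s. f (?p s) - F k (?p s)) \<longlongrightarrow> f y - F k y) (at_right 0)"
      using continuous_on_tendsto_compose[OF f_cont p] continuous_on_tendsto_compose[OF F_cont[OF k(1)] p]
      by (intro tendsto_diff) auto
    then have "\<forall>\<^sub>F s in at_right 0. f (?p s) - F k (?p s) \<noteq> 0"
      by (rule tendsto_imp_eventually_ne) (use \<open>F k y \<noteq> f y\<close> in simp)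
    then have "\<forall>\<^sub>F s in at_right 0. F k (?p s) \<noteq> f (?p s)"
      by (rule eventually_mono) simp
    then show False using k(2) by (simp add: frequently_def)
  qed
  have line: "((\<lambda>s. grad g (?p s)) has_vector_derivative hessian g y *v v) (at 0 within {0<..})"
    if "grad g differentiable (at y)" for g
  proof -
    have "(?p has_derivative (\<lambda>h. h *\<^sub>R v)) (at 0)" by (auto intro!: derivative_eq_intros)
    moreover have "(grad g has_derivative (*v) (hessian g y)) (at (?p 0))"
      using that unfolding hessian_def jacobian_works by simp
    ultimately have "((\<lambda>s. grad g (?p s)) has_derivative (\<lambda>h. hessian g y *v (h *\<^sub>R v))) (at 0)"
      by (rule has_derivative_compose)
    then show ?thesis
      by (simp add: has_vector_derivative_def matrix_vector_mult_scaleR has_derivative_at_withinI)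
  qed
  have "hessian f y *v v - hessian (F k) y *v v = 0"
  proof (rule has_vector_derivative_zero_if_frequently_zero)
    show "((\<lambda>s. grad f (?p s) - grad (F k) (?p s)) has_vector_derivative
        hessian f y *v v - hessian (F k) y *v v) (at 0 within {0<..})"
      by (intro has_vector_derivative_diff line not_Omega2D(2)[OF y] grad_diff k(1))
    show "grad f (?p 0) - grad (F k) (?p 0) = 0"
      using grad_active[OF not_Omega2D(1)[OF y] k(1) act] by simp
  qed (fact fr)
  then show ?thesis using k(1) by auto
qed

text \<open>A point of an open set with the fewest active indices has the same active indices nearby.\<close>

lemma dense_not_Omega2: "closure (- Omega2 f) = UNIV"
proof -
  have "W - Omega2 f \<noteq> {}" if W: "open W" "W \<noteq> {}" for W
  proof -
    define A where "A x = {k\<in>I. F k x = f x}" for x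
    obtain x where x: "x \<in> W" "\<And>y. y \<in> W \<Longrightarrow> card (A x) \<le> card (A y)"
      using ex_has_least_nat[of "\<lambda>x. x \<in> W" _ "\<lambda>x. card (A x)"] W(2) by blast
    have "\<forall>\<^sub>F y in nhds x. \<forall>k\<in>I - A x. F k y < f y"
    proof (intro eventually_ball_finite ballI)
      fix k assume k: "k \<in> I - A x"
      then have "F k x < f x" using F_le[of k x] by (auto simp: A_def)
      moreover have "open {y. F k y < f y}" using k F_cont f_cont by (intro open_Collect_less) auto
      ultimately show "\<forall>\<^sub>F y in nhds x. F k y < f y" by (auto simp: eventually_nhds)
    qed (use finite_I in simp)
    moreover have "\<forall>\<^sub>F y in nhds x. y \<in> W"
      using W(1) x(1) by (rule eventually_nhds_in_open)
    \<comment> \<open>Indices inactive at \<open>x\<close> stay inactive nearby, so the active set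
      can only shrink; the minimality of its cardinality forbids that.\<close>
    ultimately have ev: "\<forall>\<^sub>F y in nhds x. A y = A x"
    proof eventually_elim
      case (elim y)
      then have "A y \<subseteq> A x" unfolding A_def by force
      moreover have "finite (A x)" using finite_I by (simp add: A_def)
      ultimately show ?case using x(2)[OF elim(2)] by (intro card_seteq)
    qed
    obtain k where k: "k \<in> A x" using ex_active[of x] by (auto simp: A_def)
    have "\<forall>\<^sub>F y in nhds x. f y = F k y"
      using ev
    proof eventually_elim
      case (elim y)
      then have "k \<in> A y" using k by simp
      then show ?case by (simp add: A_def)
    qed
    then have "x \<notin> Omega2 f"
      using k diff grad_diff by (intro not_Omega2_if_eventually_eq[of f "F k"]) (auto simp: A_def)
    then show ?thesis using x(1) by blast
  qed
  then have "interior (Omega2 f) = {}"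
    by (metis Diff_eq_empty_iff interior_subset open_interior)
  then show ?thesis by (simp add: closure_complement)
qed

lemma bounded_on_cball:
  assumes "\<And>k. k \<in> I \<Longrightarrow> continuous_on UNIV (G k :: real ^ 'n \<Rightarrow> 'b::real_normed_vector)"
  shows "\<exists>B. \<forall>k\<in>I. \<forall>y\<in>cball 0 R. norm (G k y) \<le> B"
proof -
  have "bounded (\<Union>k\<in>I. G k ` cball 0 R)"
    using assms
    by (intro bounded_UN finite_I ballI compact_imp_bounded compact_continuous_image compact_cball)
      (auto intro: continuous_on_subset)
  then show ?thesis unfolding bounded_iff by blast
qed

lemma weakly_convex: "weakly_convex f"
proof
  show "\<exists>C. \<forall>y\<in>cball 0 R. f differentiable (at y) \<longrightarrow> norm (grad f y) \<le> C" for R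
  proof -
    obtain B where B: "\<And>k y. k \<in> I \<Longrightarrow> y \<in> cball 0 R \<Longrightarrow> norm (grad (F k) y) \<le> B"
      using bounded_on_cball[of "\<lambda>k. grad (F k)" R, OF grad_cont] by meson
    have "norm (grad f y) \<le> B" if "y \<in> cball 0 R" "f differentiable (at y)" for y
      using ex_active[of y] grad_active[OF that(2)] B that(1) by metis
    then show ?thesis by blast
  qed
  show "bounded (hessian f ` (cball 0 R - Omega2 f))" for R
  proof -
    obtain B where B: "\<And>k y. k \<in> I \<Longrightarrow> y \<in> cball 0 R \<Longrightarrow> norm (hessian (F k) y) \<le> B"
      using bounded_on_cball[of "\<lambda>k. hessian (F k)" R, OF hess_cont] by meson
    have "norm (hessian f y) \<le> (\<Sum>i\<in>(UNIV :: 'n set). \<Sum>j\<in>(UNIV :: 'n set). B)"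
      if y: "y \<in> cball 0 R - Omega2 f" for y
    proof -
      \<comment> \<open>The direction \<open>axis j 1\<close> isolates column \<open>j\<close>.
        Different columns may come from different pieces, so the Hessian is bounded entry by
        entry.\<close>
      have entry: "\<bar>hessian f y $ i $ j\<bar> \<le> B" for i j
      proof -
        obtain k where k: "k \<in> I" "hessian f y *v axis j 1 = hessian (F k) y *v axis j 1"
          using hessian_mult_active y by blast
        then have "hessian f y $ i $ j = hessian (F k) y $ i $ j"
          by (simp add: matrix_vector_mult_basis column_def vec_eq_iff)
        also have "\<bar>\<dots>\<bar> \<le> norm (hessian (F k) y $ i)" by (rule component_le_norm_cart)
        also have "\<dots> \<le> norm (hessian (F k) y)" by (rule Finite_Cartesian_Product.norm_nth_le)
        also have "\<dots> \<le> B" using B k(1) y by blast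
        finally show ?thesis .
      qed
      have "norm (hessian f y) \<le> (\<Sum>i\<in>UNIV. norm (hessian f y $ i))"
        by (simp add: norm_vec_def L2_set_le_sum)
      also have "\<dots> \<le> (\<Sum>i\<in>(UNIV :: 'n set). \<Sum>j\<in>(UNIV :: 'n set). B)"
        by (intro sum_mono order_trans[OF norm_le_l1_cart] entry)
      finally show ?thesis .
    qed
    then show ?thesis unfolding bounded_iff by blast
  qed
  show "\<exists>C\<ge>0. \<forall>y\<in>cball 0 R - Omega2 f. \<forall>z\<in>cball 0 R.
      f y + grad f y \<bullet> (z - y) \<le> f z + C * (norm (z - y))\<^sup>2" for R
  proof -
    have "\<forall>k\<in>I. \<exists>C\<ge>0. \<forall>y\<in>cball 0 R. \<forall>z\<in>cball 0 R.
        F k y + grad (F k) y \<bullet> (z - y) \<le> F k z + C * (norm (z - y))\<^sup>2"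
      using quadratic_lower_bound diff grad_diff hess_cont by blast
    then obtain C where C: "\<And>k. k \<in> I \<Longrightarrow> C k \<ge> 0" "\<And>k y z. k \<in> I \<Longrightarrow> y \<in> cball 0 R \<Longrightarrow> z \<in> cball 0 R \<Longrightarrow>
        F k y + grad (F k) y \<bullet> (z - y) \<le> F k z + C k * (norm (z - y))\<^sup>2"
      using bchoice[of I] by metis
    \<comment> \<open>A piece active at \<open>y\<close> shares value and gradient with
      \<open>f\<close> there and lies below \<open>f\<close> at \<open>z\<close>. The sum of the
      nonnegative constants serves whichever piece is active.\<close>
    have "f y + grad f y \<bullet> (z - y) \<le> f z + sum C I * (norm (z - y))\<^sup>2"
      if y: "y \<in> cball 0 R - Omega2 f" and z: "z \<in> cball 0 R" for y z
    proof -
      obtain k where k: "k \<in> I" "F k y = f y" using ex_active by blast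
      have "f y + grad f y \<bullet> (z - y) \<le> F k z + C k * (norm (z - y))\<^sup>2"
        using C(2)[OF k(1), of y z] y z k grad_active[OF not_Omega2D(1) k] by simp
      also have "\<dots> \<le> f z + sum C I * (norm (z - y))\<^sup>2"
        using C(1) finite_I k(1) by (intro add_mono F_le mult_right_mono member_le_sum) auto
      finally show ?thesis .
    qed
    then show ?thesis using C(1) by (intro exI[of _ "sum C I"]) (auto intro: sum_nonneg)
  qed
qed (fact f_cont dense_not_Omega2)+

end

lemma max_type_weakly_convex:
  fixes f :: "real ^ 'n \<Rightarrow> real"
  assumes "max_type f"
  shows "weakly_convex f"
proof -
  obtain I :: "nat set" and F where I: "finite I" "I \<noteq> {}" "\<And>x. f x = Max ((\<lambda>k. F k x) ` I)"
    and C3: "\<And>k. k \<in> I \<Longrightarrow> Ck_on 3 UNIV (F k)"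
    using assms unfolding max_type_def by blast
  interpret C2_max f I F
    by (rule C2_max.intro) (fact I | rule Ck_on_3D[OF C3], assumption)+
  show ?thesis by (rule weakly_convex)
qed

section \<open>Combination of the two cases\<close>

theorem theorem10:
  fixes f :: "real ^ 'n \<Rightarrow> real"
    and x0 :: "real ^ 'n"
    and \<epsilon> \<tau> :: "nat \<Rightarrow> real"
    and zbar :: "real ^ 'n \<Rightarrow> real \<Rightarrow> real ^ 'n"
  assumes "(convex_on UNIV f \<and> locally_Lipschitz f \<and> Omega2 f \<in> null_sets lebesgue \<and>
            (\<forall>x. \<exists>V. open V \<and> x \<in> V \<and> bounded (hessian f ` (V - Omega2 f))))
         \<or> max_type f"
    and "\<And>j. j \<ge> 1 \<Longrightarrow> \<epsilon> j > 0" and "\<epsilon> \<longlonglongrightarrow> 0"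
    and "\<And>j. j \<ge> 1 \<Longrightarrow> \<tau> j > 0" and "\<tau> \<longlonglongrightarrow> 0"
    and "is_minimizer_choice f zbar"
    and "bounded {y. f y \<le> f x0}"
  shows "(\<exists>a. accumulation_point (outer_iterate f zbar \<epsilon> \<tau> x0) a) \<and>
         (\<forall>a. accumulation_point (outer_iterate f zbar \<epsilon> \<tau> x0) a \<longrightarrow>
            critical f a \<and> (\<lambda>l. f (all_iterates f zbar \<epsilon> \<tau> x0 l)) \<longlonglongrightarrow> f a)"
  using assms weakly_convexI_convex max_type_weakly_convex
  by (intro weakly_convex.descent_method_convergence) auto

end
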